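(* Let $\mathcal{L}:\mathbb{R}^d\to\mathbb{R}$ be convex and $\beta$-smooth with a minimizer $y^\ast$, let $\mathcal{L}^\ast=\mathcal{L}(y^\ast)$, $d_0=\|y_0-y^\ast\|$, and suppose $\nabla\mathcal{L}$ has a dyadic hierarchy $(A_k)_k$ of rate $\gamma>0$ and prefactor $c$. For every $\varepsilon>0$, and with a step size $$\eta\le\min\Big\{\frac{1}{4\beta},\frac{d_0^2}{\varepsilon}\Big\}\ \text{ when }\gamma>2,\qquad \eta=\frac{1}{4\beta}\ \text{ when }\gamma\le 2,$$ there are hyperparameters $T,\delta,\sigma$, none of which depends on $\gamma$, such that the iteration $$y_{t+1}=y_t-\eta\,\tilde f_{\delta,\sigma}(y_t),\qquad t=0,\dots,T-1,$$ with independent draws of the multilevel oracle $\tilde f_{\delta,\sigma}$ across steps, satisfies the following. (a) Convex. With $T=\lceil\frac{4d_0^2}{\eta\varepsilon}\rceil$, $\delta=\frac{\varepsilon}{16d_0}$ and $\sigma^2=\frac{\varepsilon}{4\eta}$, the averaged iterate $\bar y_T=\frac1T\sum_{t<T}y_t$ satisfies $\mathbb{E}[\mathcal{L}(\bar y_T)-\mathcal{L}^\ast]\le\varepsilon$ at expected cost $$\mathbb{E}[\mathrm{Cost}]\le\Lambda_\gamma\cdot\begin{cases}(c\,d_0/\varepsilon)^\gamma,&\gamma>2,\\ c^2d_0^2\,\varepsilon^{-2}\log^2\frac{\beta d_0^2}{\varepsilon},&\gamma=2,\\ c^\gamma d_0^2\,\beta^{1-\frac\gamma2}\,\varepsilon^{-(1+\frac\gamma2)},&\gamma<2.\end{cases}$$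 (b) Strongly convex. If $\mathcal{L}$ is moreover $\mu$-strongly convex ($0<\mu\le\beta$, $\kappa=\beta/\mu$) and $\varepsilon\le\mu d_0^2$, then with $T=\lceil\frac{4}{\eta\mu}\log\frac{256\mu d_0^2}{\varepsilon}\rceil$, $\delta=\frac{\sqrt{\mu\varepsilon}}{8}$ and $\sigma^2=\frac{\varepsilon}{8\eta}$, the geometrically weighted average $\hat y_T\propto\sum_{t<T}(1-\eta\mu)^{-t}y_t$ (weights normalized to sum to one) satisfies $\mathbb{E}[\mathcal{L}(\hat y_T)-\mathcal{L}^\ast]\le\varepsilon$ at expected cost $$\mathbb{E}[\mathrm{Cost}]\le\Lambda'_\gamma\Big(1+\log\frac{\mu d_0^2}{\varepsilon}\Big)\cdot\begin{cases}(c/\sqrt{\mu\varepsilon})^\gamma,&\gamma>2,\\ c^2(\mu\varepsilon)^{-1}\log^2\kappa,&\gamma=2,\\ c^\gamma(\mu\varepsilon)^{-\frac\gamma2}\,\kappa^{1-\frac\gamma2},&\gamma<2.\end{cases}$$ Here $\Lambda_\gamma$ and $\Lambda'_\gamma$ depend only on $\gamma$. By contrast, running the same iteration with the deterministic algorithm $A_{k_{\max}}$ in place of $\tilde f_{\delta,\sigma}$ costs $\Theta\big(\beta d_0^2\varepsilon^{-1}\cdot(cd_0/\varepsilon)^\gamma\big)=\Theta(\varepsilon^{-(\gamma+1)})$ in the convex case.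
   Context: Dyadic hierarchy of rate $\gamma$ and prefactor $c$ for $f=\nabla\mathcal{L}$: a family of deterministic algorithms $A_k$ (integer $k$) computing maps $\mathbb{R}^d\to\mathbb{R}^d$ with $\sup_y\|A_k(y)-f(y)\|\le 2^{-k}$ and $\mathrm{Cost}(A_k)\le c^\gamma2^{\gamma k}$, where $\mathrm{Cost}$ is the compute of one evaluation. Multilevel oracle: for $\delta=2^{-k_{\max}}$ (in general, $k_{\max}$ is the least integer with $2^{-k_{\max}}\le\delta$) and $\sigma>0$, $$\tilde f_{\delta,\sigma}=\sum_{k=k_{\min}}^{k_{\max}}\frac{B_k}{p_k}(A_k-A_{k-1}),\qquad p_k=\min\{C2^{-(1+\gamma/2)k},1\},$$ with independent $B_k\sim\mathrm{Bernoulli}(p_k)$ drawn at each call. Here $k_{\min}-1=\lfloor-\log_2c\rfloor$ and $A_{k_{\min}-1}$, whose compute is at most $1$, is taken to be the constant $0$. The constant $C$ is chosen, depending on $\gamma,c,\delta,\sigma$, so that the variance $\mathbb{E}\|\tilde f_{\delta,\sigma}(y)-\mathbb{E}\tilde f_{\delta,\sigma}(y)\|^2$ is at most $\sigma^2$ at the least (guaranteed) expected compute. The bias $\|\mathbb{E}\tilde f_{\delta,\sigma}(y)-f(y)\|$ is at most $\delta$. The compute of a call is the sum of the compute of the increments drawn (those with $B_k=1$), a run of consecutive levels with $p_k=1$ starting from the coarsest counting as a single evaluation of its finest level. The total cost is the sum of the compute of the $T$ calls, so $\mathbb{E}[\mathrm{Cost}]$ is $T$ times the expected compute of one call. In the deterministic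 comparison, $A_{k_{\max}}$ has accuracy $\delta=\varepsilon/(16d_0)$, $\sigma=0$, the step is the largest admissible one $\eta=\frac1{4\beta}$, and each call is charged $(c/\delta)^\gamma$.
   Formalization: For γ=2 the factors log(βd0²/ε) and log κ are read as max(1, log); for γ<2 the cost bound in (a) is claimed only for ε ≤ 4βd0²; the constant 0 at level k_min−1 is assumed accurate only at the visited iterates; d0, c, β, η are positive. *)

theory Defs
  imports
    "HOL-Analysis.Analysis"
    "HOL-Probability.Probability"
    "HOL-Probability.Product_PMF"
    "HOL-Library.Landau_Symbols"
begin

section \<open>Objective\<close>

definition smooth_with_gradient ::
    "real \<Rightarrow> ('a::euclidean_space \<Rightarrow> real) \<Rightarrow> ('a \<Rightarrow> 'a) \<Rightarrow> bool" where
  "smooth_with_gradient \<beta> L f \<longleftrightarrow> (\<forall>y. GDERIV L y :> f y) \<and> \<beta>-lipschitz_on UNIV f"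

definition strongly_convex :: "real \<Rightarrow> ('a::euclidean_space \<Rightarrow> real) \<Rightarrow> bool" where
  "strongly_convex \<mu> L \<longleftrightarrow>
     (\<forall>x y. \<forall>t\<in>{0..1}. L ((1 - t) *\<^sub>R x + t *\<^sub>R y)
        \<le> (1 - t) * L x + t * L y - \<mu> / 2 * t * (1 - t) * (norm (x - y))\<^sup>2)"

section \<open>Dyadic hierarchies\<close>

text \<open>An algorithm is represented by the map it computes together with the compute
  \<open>cost k\<close> of one evaluation.\<close>

definition dyadic_hierarchy ::
    "real \<Rightarrow> real \<Rightarrow> ('a::euclidean_space \<Rightarrow> 'a) \<Rightarrow> (int \<Rightarrow> 'a \<Rightarrow> 'a) \<Rightarrow> (int \<Rightarrow> real) \<Rightarrow> bool" where
  "dyadic_hierarchy \<gamma> c f A cost \<longleftrightarrow>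
     (\<forall>k y. norm (A k y - f y) \<le> 2 powr (- of_int k)) \<and>
     (\<forall>k. 0 \<le> cost k \<and> cost k \<le> c powr \<gamma> * 2 powr (\<gamma> * of_int k))"

definition k_max :: "real \<Rightarrow> int" where
  "k_max \<delta> = (LEAST k. 2 powr (- of_int k) \<le> \<delta>)"

definition k_min :: "real \<Rightarrow> int" where
  "k_min c = \<lfloor>- log 2 c\<rfloor> + 1"

definition zero_base :: "real \<Rightarrow> (int \<Rightarrow> 'a \<Rightarrow> 'a) \<Rightarrow> int \<Rightarrow> 'a \<Rightarrow> 'a::euclidean_space" where
  "zero_base c A = A(k_min c - 1 := (\<lambda>_. 0))"

text \<open>The constant \<open>0\<close> can serve as level \<open>k_min c - 1\<close> at the point \<open>y\<close>.  Demanding this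
  at every point of the space would bound the gradient and so exclude every strongly convex
  objective; it is only needed at the points where the multilevel gradient is queried.\<close>

definition zero_accurate :: "real \<Rightarrow> ('a::euclidean_space \<Rightarrow> 'a) \<Rightarrow> 'a \<Rightarrow> bool" where
  "zero_accurate c f y \<longleftrightarrow> norm (0 - f y) \<le> 2 powr (- of_int (k_min c - 1))"

lemma zero_accurate_if_in_hierarchy:
  assumes "dyadic_hierarchy \<gamma> c f A cost" and "A (k_min c - 1) = (\<lambda>_. 0)"
  shows "zero_accurate c f y"
  using assms unfolding dyadic_hierarchy_def zero_accurate_def by metis

section \<open>Multilevel Monte Carlo gradient\<close>

definition level_prob :: "real \<Rightarrow> real \<Rightarrow> int \<Rightarrow> real" where
  "level_prob \<gamma> C k = min (C * 2 powr (- (1 + \<gamma> / 2) * of_int k)) 1"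

definition call_draw :: "real \<Rightarrow> real \<Rightarrow> real \<Rightarrow> real \<Rightarrow> (int \<Rightarrow> bool) pmf" where
  "call_draw \<gamma> c \<delta> C =
     Pi_pmf {k_min c..k_max \<delta>} False (\<lambda>k. bernoulli_pmf (level_prob \<gamma> C k))"

definition ml_gradient ::
    "real \<Rightarrow> real \<Rightarrow> real \<Rightarrow> real \<Rightarrow> (int \<Rightarrow> 'a::euclidean_space \<Rightarrow> 'a) \<Rightarrow> (int \<Rightarrow> bool) \<Rightarrow> 'a \<Rightarrow> 'a" where
  "ml_gradient \<gamma> c \<delta> C A b y =
     (\<Sum>k\<in>{k_min c..k_max \<delta>}. (of_bool (b k) / level_prob \<gamma> C k) *\<^sub>R
        (zero_base c A k y - zero_base c A (k - 1) y))"

definition oracle_variance ::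
    "real \<Rightarrow> real \<Rightarrow> real \<Rightarrow> real \<Rightarrow> (int \<Rightarrow> 'a::euclidean_space \<Rightarrow> 'a) \<Rightarrow> 'a \<Rightarrow> real" where
  "oracle_variance \<gamma> c \<delta> C A y =
     measure_pmf.expectation (call_draw \<gamma> c \<delta> C)
       (\<lambda>b. (norm (ml_gradient \<gamma> c \<delta> C A b y
          - measure_pmf.expectation (call_draw \<gamma> c \<delta> C) (\<lambda>b'. ml_gradient \<gamma> c \<delta> C A b' y)))\<^sup>2)"

definition sure_run :: "real \<Rightarrow> real \<Rightarrow> real \<Rightarrow> real \<Rightarrow> int set" where
  "sure_run \<gamma> c \<delta> C =
     {k \<in> {k_min c..k_max \<delta>}. \<forall>j\<in>{k_min c..k}. level_prob \<gamma> C j = 1}"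

text \<open>An increment is the difference of two levels and is charged for evaluating both; this
  includes \<open>cost (k_min c - 1)\<close>, which is at most \<open>1\<close>.\<close>

definition call_cost ::
    "real \<Rightarrow> real \<Rightarrow> real \<Rightarrow> real \<Rightarrow> (int \<Rightarrow> real) \<Rightarrow> (int \<Rightarrow> bool) \<Rightarrow> real" where
  "call_cost \<gamma> c \<delta> C cost b =
     (if sure_run \<gamma> c \<delta> C = {} then 0 else cost (Max (sure_run \<gamma> c \<delta> C))) +
     (\<Sum>k\<in>{k_min c..k_max \<delta>} - sure_run \<gamma> c \<delta> C. of_bool (b k) * (cost k + cost (k - 1)))"

section \<open>Choice of the constant\<close>

text \<open>The constant may depend only on \<open>\<gamma>\<close>, \<open>c\<close>, \<open>\<delta>\<close>, \<open>\<sigma>\<close>, so the variance bound has to hold for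
  every family with the dyadic accuracies, and compute is measured by the guaranteed costs
  \<open>c powr \<gamma> * 2 powr (\<gamma> * k)\<close>.  The expected compute is not monotone in \<open>C\<close>: it drops
  whenever a further level joins the run of levels of probability one.\<close>

definition variance_guaranteed ::
    "'a::euclidean_space itself \<Rightarrow> real \<Rightarrow> real \<Rightarrow> real \<Rightarrow> real \<Rightarrow> real \<Rightarrow> bool" where
  "variance_guaranteed TYPE('a) \<gamma> c \<delta> \<sigma> C \<longleftrightarrow>
     (\<forall>(f :: 'a \<Rightarrow> 'a) A y. (\<forall>k. norm (zero_base c A k y - f y) \<le> 2 powr (- of_int k)) \<longrightarrow>
        oracle_variance \<gamma> c \<delta> C A y \<le> \<sigma>\<^sup>2)"

definition guaranteed_compute :: "real \<Rightarrow> real \<Rightarrow> real \<Rightarrow> real \<Rightarrow> real" where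
  "guaranteed_compute \<gamma> c \<delta> C =
     measure_pmf.expectation (call_draw \<gamma> c \<delta> C)
       (call_cost \<gamma> c \<delta> C (\<lambda>k. c powr \<gamma> * 2 powr (\<gamma> * of_int k)))"

definition optimal_constant ::
    "'a::euclidean_space itself \<Rightarrow> real \<Rightarrow> real \<Rightarrow> real \<Rightarrow> real \<Rightarrow> real \<Rightarrow> bool" where
  "optimal_constant TYPE('a) \<gamma> c \<delta> \<sigma> C \<longleftrightarrow>
     C > 0 \<and> variance_guaranteed TYPE('a) \<gamma> c \<delta> \<sigma> C \<and>
     (\<forall>C'>0. variance_guaranteed TYPE('a) \<gamma> c \<delta> \<sigma> C' \<longrightarrow>
        guaranteed_compute \<gamma> c \<delta> C \<le> guaranteed_compute \<gamma> c \<delta> C')"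

definition ml_const ::
    "'a::euclidean_space itself \<Rightarrow> real \<Rightarrow> real \<Rightarrow> real \<Rightarrow> real \<Rightarrow> real" where
  "ml_const TYPE('a) \<gamma> c \<delta> \<sigma> = (SOME C. optimal_constant TYPE('a) \<gamma> c \<delta> \<sigma> C)"

section \<open>Stochastic iteration\<close>

definition run_draws ::
    "'a::euclidean_space itself \<Rightarrow> real \<Rightarrow> real \<Rightarrow> real \<Rightarrow> real \<Rightarrow> nat \<Rightarrow> (nat \<Rightarrow> int \<Rightarrow> bool) pmf" where
  "run_draws TYPE('a) \<gamma> c \<delta> \<sigma> T =
     Pi_pmf {..<T} (\<lambda>_. False) (\<lambda>_. call_draw \<gamma> c \<delta> (ml_const TYPE('a) \<gamma> c \<delta> \<sigma>))"

primrec iterate ::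
    "real \<Rightarrow> real \<Rightarrow> real \<Rightarrow> real \<Rightarrow> (int \<Rightarrow> 'a::euclidean_space \<Rightarrow> 'a) \<Rightarrow> real \<Rightarrow> 'a
      \<Rightarrow> (nat \<Rightarrow> int \<Rightarrow> bool) \<Rightarrow> nat \<Rightarrow> 'a" where
  "iterate \<gamma> c \<delta> \<sigma> A \<eta> y0 \<omega> 0 = y0"
| "iterate \<gamma> c \<delta> \<sigma> A \<eta> y0 \<omega> (Suc t) =
     iterate \<gamma> c \<delta> \<sigma> A \<eta> y0 \<omega> t -
     \<eta> *\<^sub>R ml_gradient \<gamma> c \<delta> (ml_const TYPE('a) \<gamma> c \<delta> \<sigma>) A (\<omega> t) (iterate \<gamma> c \<delta> \<sigma> A \<eta> y0 \<omega> t)"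

definition expected_cost ::
    "'a::euclidean_space itself \<Rightarrow> real \<Rightarrow> real \<Rightarrow> real \<Rightarrow> real \<Rightarrow> (int \<Rightarrow> real) \<Rightarrow> nat \<Rightarrow> real" where
  "expected_cost TYPE('a) \<gamma> c \<delta> \<sigma> cost T =
     measure_pmf.expectation (run_draws TYPE('a) \<gamma> c \<delta> \<sigma> T)
       (\<lambda>\<omega>. \<Sum>t<T. call_cost \<gamma> c \<delta> (ml_const TYPE('a) \<gamma> c \<delta> \<sigma>) cost (\<omega> t))"

definition average :: "nat \<Rightarrow> (nat \<Rightarrow> 'a::euclidean_space) \<Rightarrow> 'a" where
  "average T ys = (1 / real T) *\<^sub>R (\<Sum>t<T. ys t)"

definition geometric_average :: "real \<Rightarrow> nat \<Rightarrow> (nat \<Rightarrow> 'a::euclidean_space) \<Rightarrow> 'a" where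
  "geometric_average q T ys =
     (1 / (\<Sum>t<T. q powr (- real t))) *\<^sub>R (\<Sum>t<T. q powr (- real t) *\<^sub>R ys t)"

section \<open>Hyperparameters and rates\<close>

definition T_convex :: "real \<Rightarrow> real \<Rightarrow> real \<Rightarrow> nat" where
  "T_convex d0 \<eta> \<epsilon> = nat \<lceil>4 * d0\<^sup>2 / (\<eta> * \<epsilon>)\<rceil>"

definition \<delta>_convex :: "real \<Rightarrow> real \<Rightarrow> real" where
  "\<delta>_convex d0 \<epsilon> = \<epsilon> / (16 * d0)"

definition \<sigma>_convex :: "real \<Rightarrow> real \<Rightarrow> real" where
  "\<sigma>_convex \<eta> \<epsilon> = sqrt (\<epsilon> / (4 * \<eta>))"

definition T_strong :: "real \<Rightarrow> real \<Rightarrow> real \<Rightarrow> real \<Rightarrow> nat" where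
  "T_strong \<mu> d0 \<eta> \<epsilon> = nat \<lceil>4 / (\<eta> * \<mu>) * ln (256 * \<mu> * d0\<^sup>2 / \<epsilon>)\<rceil>"

definition \<delta>_strong :: "real \<Rightarrow> real \<Rightarrow> real" where
  "\<delta>_strong \<mu> \<epsilon> = sqrt (\<mu> * \<epsilon>) / 8"

definition \<sigma>_strong :: "real \<Rightarrow> real \<Rightarrow> real" where
  "\<sigma>_strong \<eta> \<epsilon> = sqrt (\<epsilon> / (8 * \<eta>))"

text \<open>Logarithms that occur as factors of a rate are bounded below by \<open>1\<close>: the rates would
  otherwise vanish at \<open>\<epsilon> = \<beta> * d0\<^sup>2\<close> and at \<open>\<beta> = \<mu>\<close>, where the cost does not.\<close>

definition log1 :: "real \<Rightarrow> real" where
  "log1 x = max 1 (ln x)"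

definition convex_rate :: "real \<Rightarrow> real \<Rightarrow> real \<Rightarrow> real \<Rightarrow> real \<Rightarrow> real" where
  "convex_rate \<gamma> c \<beta> d0 \<epsilon> =
     (if \<gamma> > 2 then (c * d0 / \<epsilon>) powr \<gamma>
      else if \<gamma> = 2 then c\<^sup>2 * d0\<^sup>2 * \<epsilon> powr (-2) * (log1 (\<beta> * d0\<^sup>2 / \<epsilon>))\<^sup>2
      else c powr \<gamma> * d0\<^sup>2 * \<beta> powr (1 - \<gamma> / 2) * \<epsilon> powr (- (1 + \<gamma> / 2)))"

definition strong_rate :: "real \<Rightarrow> real \<Rightarrow> real \<Rightarrow> real \<Rightarrow> real \<Rightarrow> real" where
  "strong_rate \<gamma> c \<beta> \<mu> \<epsilon> =
     (if \<gamma> > 2 then (c / sqrt (\<mu> * \<epsilon>)) powr \<gamma>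
      else if \<gamma> = 2 then c\<^sup>2 * (\<mu> * \<epsilon>) powr (-1) * (log1 (\<beta> / \<mu>))\<^sup>2
      else c powr \<gamma> * (\<mu> * \<epsilon>) powr (- \<gamma> / 2) * (\<beta> / \<mu>) powr (1 - \<gamma> / 2))"

text \<open>One constant that serves for both rates.  It is explicit, rather than existentially
  quantified in a theorem with a type variable for the space, so that it cannot depend on the
  dimension.  Its value is not meant to be sharp.\<close>

definition rate_const :: "real \<Rightarrow> real" where
  "rate_const \<gamma> =
     (if \<gamma> = 2 then 2 ^ 40 else 2 ^ 30 * 32 powr \<gamma> / (1 - 2 powr (- \<bar>\<gamma> / 2 - 1\<bar>))\<^sup>2)"

definition deterministic_cost :: "real \<Rightarrow> real \<Rightarrow> real \<Rightarrow> real \<Rightarrow> real \<Rightarrow> real" where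
  "deterministic_cost \<gamma> c \<beta> d0 \<epsilon> =
     (\<Sum>t<T_convex d0 (1 / (4 * \<beta>)) \<epsilon>. (c / \<delta>_convex d0 \<epsilon>) powr \<gamma>)"

end

theory Submission
  imports Defs
begin

text \<open>
  The proof separates the accuracy of a stochastic gradient method with biased noise from the
  compute of one oracle call; the rates are the product of that compute with the number of calls.

  \<^bold>\<open>Accuracy.\<close> Wherever the constant \<open>0\<close> is accurate enough for its level, one call
  has bias at most \<open>\<delta>\<close> and variance at most \<open>\<sigma>\<^sup>2\<close>. Because the gradient of a \<open>\<beta>\<close>-smooth function
  satisfies \<open>norm (f y)\<^sup>2 \<le> 2 * \<beta> * (L y - L ystar)\<close>, a step size of at most \<open>1 / (4 * \<beta>)\<close> lets half
  of the first-order progress pay for the squared gradient, and the squared distance \<open>D\<close> to the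
  minimizer obeys, with \<open>e\<close> the suboptimality,
  \<open>E D' \<le> E ((1 - \<eta> * \<mu>) * D - \<eta> * e + 2 * \<eta> * \<delta> * sqrt D + \<eta>\<^sup>2 * (2 * \<delta>\<^sup>2 + \<sigma>\<^sup>2))\<close>
  (\<open>expected_distance_step\<close>). Only the bias term is unusual: it grows with the distance. In the
  convex case the run is short enough that the root mean squared distance at most doubles
  (\<open>convex_recurrence\<close>); in the strongly convex case \<open>D\<close> is controlled by \<open>e\<close> itself, and the weights
  \<open>(1 - \<eta> * \<mu>) powr (- t)\<close> are exactly those that make the recurrence telescope
  (\<open>strong_recurrence\<close>).

  \<^bold>\<open>Compute of one call.\<close> The constant of the oracle is only known to minimise the guaranteed
  compute, so it is bounded by comparison with a constant chosen by hand
  (\<open>optimal_call_cost_le\<close>); this needs the minimum to be attained (\<open>optimal_constant_exists\<close>).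
  Write the comparison constant as \<open>M powr (1 + \<gamma> / 2)\<close>. Levels with \<open>2 powr k \<le> M\<close> are then drawn
  surely: they cause no variance and count as a single evaluation of cost at most
  \<open>(c * M) powr \<gamma>\<close>. A finer level \<open>k\<close> contributes a multiple of \<open>2 powr ((\<gamma> / 2 - 1) * k)\<close> both to the
  variance and to the compute. This sum \<open>S\<close> is a geometric series dominated by its finest term if
  \<open>\<gamma> > 2\<close>, by its coarsest if \<open>\<gamma> < 2\<close>, and is the number of levels if \<open>\<gamma> = 2\<close>. Since the sum starts at
  \<open>M\<close> instead of at the coarsest level of the hierarchy, the number of levels that matter is
  about \<open>log 2 (\<sigma> / \<delta>)\<close> and does not involve \<open>c\<close>; this is why the squared logarithms in the rates for
  \<open>\<gamma> = 2\<close> are those of \<open>\<beta> * d0\<^sup>2 / \<epsilon>\<close> and of \<open>\<beta> / \<mu>\<close>.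
\<close>

section \<open>Finitely supported products\<close>

lemma expectation_pair_pmf_finite:
  fixes F :: "'a \<times> 'b \<Rightarrow> 'c::{banach, second_countable_topology}"
  assumes p: "finite (set_pmf p)" and q: "finite (set_pmf q)"
  shows "measure_pmf.expectation (pair_pmf p q) F =
         measure_pmf.expectation q (\<lambda>b. measure_pmf.expectation p (\<lambda>a. F (a, b)))"
proof -
  have "measure_pmf.expectation (pair_pmf p q) F =
      (\<Sum>x\<in>set_pmf p \<times> set_pmf q. pmf (pair_pmf p q) x *\<^sub>R F x)"
    by (rule integral_measure_pmf) (use p q in auto)
  also have "\<dots> = (\<Sum>a\<in>set_pmf p. \<Sum>b\<in>set_pmf q. (pmf p a * pmf q b) *\<^sub>R F (a, b))"
    by (simp add: sum.cartesian_product pmf_pair case_prod_unfold flip: pmf_pair)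
  also have "\<dots> = (\<Sum>b\<in>set_pmf q. \<Sum>a\<in>set_pmf p. (pmf p a * pmf q b) *\<^sub>R F (a, b))"
    by (rule sum.swap)
  also have "\<dots> = (\<Sum>b\<in>set_pmf q. pmf q b *\<^sub>R (\<Sum>a\<in>set_pmf p. pmf p a *\<^sub>R F (a, b)))"
    by (simp add: scaleR_sum_right mult.commute)
  also have "\<dots> = (\<Sum>b\<in>set_pmf q. pmf q b *\<^sub>R measure_pmf.expectation p (\<lambda>a. F (a, b)))"
    by (intro sum.cong refl arg_cong2[where f = scaleR] integral_measure_pmf[symmetric])
       (use p in auto)
  also have "\<dots> = measure_pmf.expectation q (\<lambda>b. measure_pmf.expectation p (\<lambda>a. F (a, b)))"
    by (rule integral_measure_pmf[symmetric]) (use q in auto)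
  finally show ?thesis .
qed

lemma finite_set_Pi_pmf:
  assumes "finite I" "\<And>i. i \<in> I \<Longrightarrow> finite (set_pmf (p i))"
  shows "finite (set_pmf (Pi_pmf I dflt p))"
  using assms by (simp add: set_Pi_pmf finite_PiE_dflt)

text \<open>One coordinate of a product can be drawn last. For a run of the iteration this is the statement
  that the draws of step \<open>i\<close> are independent of everything that happened before.\<close>

lemma expectation_Pi_pmf_resample:
  fixes F :: "('i \<Rightarrow> 'b) \<Rightarrow> 'c::{banach, second_countable_topology}"
  assumes I: "finite I" "i \<in> I" and p: "\<And>j. j \<in> I \<Longrightarrow> finite (set_pmf (p j))"
  shows "measure_pmf.expectation (Pi_pmf I dflt p) F =
         measure_pmf.expectation (Pi_pmf (I - {i}) dflt p)
           (\<lambda>w. measure_pmf.expectation (p i) (\<lambda>b. F (w(i := b))))"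
proof -
  have "Pi_pmf I dflt p =
      map_pmf (\<lambda>(y, f). f(i := y)) (pair_pmf (p i) (Pi_pmf (I - {i}) dflt p))"
    using Pi_pmf_insert[of "I - {i}" i dflt p] I by (simp add: insert_absorb)
  moreover have "finite (set_pmf (p i))" "finite (set_pmf (Pi_pmf (I - {i}) dflt p))"
    using I p by (auto intro: finite_set_Pi_pmf)
  ultimately show ?thesis
    by (simp add: case_prod_unfold expectation_pair_pmf_finite)
qed

lemma expectation_Pi_pmf_component:
  fixes g :: "'b \<Rightarrow> 'c::{banach, second_countable_topology}"
  assumes "finite I" "i \<in> I"
  shows "measure_pmf.expectation (Pi_pmf I dflt p) (\<lambda>w. g (w i)) = measure_pmf.expectation (p i) g"
  using arg_cong[OF Pi_pmf_component[OF assms(1), of i dflt p],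
    where f = "\<lambda>M. measure_pmf.expectation M g"] assms(2)
  by simp

lemma expectation_Pi_pmf_uncorrelated:
  fixes g h :: "'b \<Rightarrow> real"
  assumes I: "finite I" "k \<in> I" and "k \<noteq> l"
    and p: "\<And>j. j \<in> I \<Longrightarrow> finite (set_pmf (p j))"
    and centred: "measure_pmf.expectation (p k) g = 0"
  shows "measure_pmf.expectation (Pi_pmf I dflt p) (\<lambda>w. g (w k) * h (w l)) = 0"
  using \<open>k \<noteq> l\<close>
  by (subst expectation_Pi_pmf_resample[OF I p]) (simp_all add: centred)

text \<open>The bias-variance decomposition of the squared distance after a step \<open>\<eta>\<close> along a random
  direction \<open>X\<close>.\<close>

lemma second_moment_about_shift:
  fixes X :: "'b \<Rightarrow> 'v::euclidean_space" and M :: "'b pmf" and u :: 'v and \<eta> :: real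
  assumes fin: "finite (set_pmf M)"
  defines "m \<equiv> measure_pmf.expectation M X"
  shows "measure_pmf.expectation M (\<lambda>b. (norm (u - \<eta> *\<^sub>R X b))\<^sup>2) =
      (norm u)\<^sup>2 - 2 * \<eta> * (m \<bullet> u)
      + \<eta>\<^sup>2 * ((norm m)\<^sup>2 + measure_pmf.expectation M (\<lambda>b. (norm (X b - m))\<^sup>2))"
proof -
  note [simp] = integrable_measure_pmf_finite[OF fin]
  have pt: "(norm (u - \<eta> *\<^sub>R X b))\<^sup>2 = (norm u)\<^sup>2 - 2 * \<eta> * (X b \<bullet> u)
      + \<eta>\<^sup>2 * ((norm (X b - m))\<^sup>2 + 2 * (X b \<bullet> m) - (norm m)\<^sup>2)" for b
    unfolding power2_norm_eq_inner
    by (simp add: inner_diff_left inner_diff_right algebra_simps inner_commute power2_eq_square)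
  show ?thesis
    unfolding pt by (simp add: m_def[symmetric] power2_norm_eq_inner algebra_simps)
qed

section \<open>The multilevel oracle\<close>

text \<open>The second bound is the failure of the level \<open>k_max \<delta> - 1\<close> to have accuracy \<open>\<delta>\<close>; it limits what the
  finest level can cost.\<close>

lemma k_max_bounds:
  assumes "\<delta> > 0"
  shows "2 powr (- of_int (k_max \<delta>)) \<le> \<delta>" and "2 powr (of_int (k_max \<delta>)) < 2 / \<delta>"
proof -
  have le_iff: "2 powr (- of_int k) \<le> \<delta> \<longleftrightarrow> \<lceil>- log 2 \<delta>\<rceil> \<le> k" for k :: int
    using le_log_iff[of 2 \<delta> "- of_int k"] assms by (auto simp: ceiling_le_iff)
  have k: "k_max \<delta> = \<lceil>- log 2 \<delta>\<rceil>"
    unfolding k_max_def le_iff by (rule Least_equality) auto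
  show "2 powr (- of_int (k_max \<delta>)) \<le> \<delta>"
    by (simp add: le_iff k)
  have "of_int (k_max \<delta>) < 1 - log 2 \<delta>"
    unfolding k by linarith
  also have "1 - log 2 \<delta> = log 2 (2 / \<delta>)"
    using assms by (simp add: log_divide)
  finally show "2 powr (of_int (k_max \<delta>)) < 2 / \<delta>"
    using assms by (simp add: less_log_iff)
qed

lemma level_prob_pos: "C > 0 \<Longrightarrow> level_prob \<gamma> C k > 0"
  and level_prob_le_1: "level_prob \<gamma> C k \<le> 1"
  by (simp_all add: level_prob_def)

lemma level_prob_eq_1_iff: "level_prob \<gamma> C k = 1 \<longleftrightarrow> 2 powr ((1 + \<gamma> / 2) * of_int k) \<le> C"
proof -
  have "level_prob \<gamma> C k = 1 \<longleftrightarrow> 1 \<le> C * 2 powr (- ((1 + \<gamma> / 2) * of_int k))"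
    by (simp add: level_prob_def min_def algebra_simps)
  also have "\<dots> \<longleftrightarrow> 2 powr ((1 + \<gamma> / 2) * of_int k) \<le> C"
    by (simp add: powr_minus field_simps)
  finally show ?thesis .
qed

text \<open>The levels of probability one are automatically consecutive from the coarsest on, because
  \<open>level_prob\<close> decreases in the level.\<close>

lemma sure_run_eq:
  assumes "\<gamma> > 0"
  shows "sure_run \<gamma> c \<delta> C = {k \<in> {k_min c..k_max \<delta>}. 2 powr ((1 + \<gamma> / 2) * of_int k) \<le> C}"
proof -
  have "2 powr ((1 + \<gamma> / 2) * of_int j) \<le> C"
    if "2 powr ((1 + \<gamma> / 2) * of_int k) \<le> C" "j \<le> k" for j k :: int
    using that assms by (intro order.trans[OF _ that(1)]) (simp add: mult_left_mono)
  then show ?thesis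
    unfolding sure_run_def level_prob_eq_1_iff by auto
qed

lemma finite_call_draw: "finite (set_pmf (call_draw \<gamma> c \<delta> C))"
  unfolding call_draw_def by (rule finite_set_Pi_pmf) auto

context
  fixes \<gamma> c \<delta> C :: real
  assumes C: "C > 0"
begin

lemma expectation_draw:
  assumes "k \<in> {k_min c..k_max \<delta>}"
  shows "measure_pmf.expectation (call_draw \<gamma> c \<delta> C) (\<lambda>b. g (b k) :: real) =
     g True * level_prob \<gamma> C k + g False * (1 - level_prob \<gamma> C k)"
  unfolding call_draw_def using assms level_prob_pos[OF C, of \<gamma> k] level_prob_le_1[of \<gamma> C k]
  by (subst expectation_Pi_pmf_component) auto

lemma expectation_ml_gradient:
  "measure_pmf.expectation (call_draw \<gamma> c \<delta> C) (\<lambda>b. ml_gradient \<gamma> c \<delta> C A b y) =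
     (\<Sum>k\<in>{k_min c..k_max \<delta>}. zero_base c A k y - zero_base c A (k - 1) y)"
proof -
  note [simp] = integrable_measure_pmf_finite[OF finite_call_draw]
  have unbiased: "measure_pmf.expectation (call_draw \<gamma> c \<delta> C)
      (\<lambda>b. of_bool (b k) / level_prob \<gamma> C k) = 1"
    if "k \<in> {k_min c..k_max \<delta>}" for k
    using expectation_draw[OF that, of "\<lambda>x. of_bool x / level_prob \<gamma> C k"]
      level_prob_pos[OF C, of \<gamma> k] by simp
  have "measure_pmf.expectation (call_draw \<gamma> c \<delta> C) (\<lambda>b. ml_gradient \<gamma> c \<delta> C A b y) =
      (\<Sum>k\<in>{k_min c..k_max \<delta>}. measure_pmf.expectation (call_draw \<gamma> c \<delta> C)
        (\<lambda>b. of_bool (b k) / level_prob \<gamma> C k) *\<^sub>R (zero_base c A k y - zero_base c A (k - 1) y))"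
    unfolding ml_gradient_def by (subst Bochner_Integration.integral_sum) auto
  then show ?thesis
    by (simp only: unbiased scaleR_one cong: sum.cong)
qed

text \<open>The draws of distinct levels are uncorrelated, so only the diagonal of the double sum survives,
  and \<open>B / p\<close> has variance \<open>1 / p - 1\<close>.\<close>

lemma oracle_variance_eq:
  "oracle_variance \<gamma> c \<delta> C A y =
     (\<Sum>k\<in>{k_min c..k_max \<delta>}. (1 / level_prob \<gamma> C k - 1) *
        (norm (zero_base c A k y - zero_base c A (k - 1) y))\<^sup>2)"
proof -
  note [simp] = integrable_measure_pmf_finite[OF finite_call_draw]
  let ?K = "{k_min c..k_max \<delta>}" and ?P = "call_draw \<gamma> c \<delta> C"
  define v where "v = (\<lambda>k. zero_base c A k y - zero_base c A (k - 1) y)"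
  define X where "X = (\<lambda>k b. of_bool b / level_prob \<gamma> C k - 1)"
  have centred: "measure_pmf.expectation (bernoulli_pmf (level_prob \<gamma> C k)) (X k) = 0" for k
    using level_prob_pos[OF C, of \<gamma> k] level_prob_le_1[of \<gamma> C k]
    by (simp add: X_def field_simps)
  have cov: "measure_pmf.expectation ?P (\<lambda>b. X k (b k) * X l (b l)) =
      (if k = l then 1 / level_prob \<gamma> C k - 1 else 0)" if "k \<in> ?K" "l \<in> ?K" for k l
  proof (cases "k = l")
    case True
    have "measure_pmf.expectation ?P (\<lambda>b. X k (b k) * X k (b k)) = 1 / level_prob \<gamma> C k - 1"
      unfolding expectation_draw[OF that(1), of "\<lambda>x. X k x * X k x"]
      using level_prob_pos[OF C, of \<gamma> k] by (simp add: X_def field_simps)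
    then show ?thesis
      using True by simp
  next
    case False
    then show ?thesis
      using that centred unfolding call_draw_def
      by (simp add: expectation_Pi_pmf_uncorrelated)
  qed
  have "oracle_variance \<gamma> c \<delta> C A y =
      measure_pmf.expectation ?P (\<lambda>b. (norm (\<Sum>k\<in>?K. X k (b k) *\<^sub>R v k))\<^sup>2)"
    unfolding oracle_variance_def expectation_ml_gradient
    by (simp add: ml_gradient_def X_def v_def sum_subtractf[symmetric] scaleR_diff_left)
  also have "\<dots> = measure_pmf.expectation ?P
      (\<lambda>b. \<Sum>k\<in>?K. \<Sum>l\<in>?K. (X k (b k) * X l (b l)) * (v k \<bullet> v l))"
    by (simp add: power2_norm_eq_inner inner_sum_left inner_sum_right sum_distrib_left
        mult_ac inner_commute)
  also have "\<dots> = (\<Sum>k\<in>?K. \<Sum>l\<in>?K.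
      measure_pmf.expectation ?P (\<lambda>b. X k (b k) * X l (b l)) * (v k \<bullet> v l))"
    by (simp only: Bochner_Integration.integral_sum integral_mult_left_zero
        integrable_measure_pmf_finite[OF finite_call_draw])
  also have "\<dots> = (\<Sum>k\<in>?K. \<Sum>l\<in>?K. if l = k then (1 / level_prob \<gamma> C k - 1) * (v k \<bullet> v l) else 0)"
    by (intro sum.cong refl) (simp add: cov)
  also have "\<dots> = (\<Sum>k\<in>?K. (1 / level_prob \<gamma> C k - 1) * (norm (v k))\<^sup>2)"
    by (simp add: power2_norm_eq_inner)
  finally show ?thesis
    by (simp add: v_def)
qed

lemma expectation_call_cost:
  "measure_pmf.expectation (call_draw \<gamma> c \<delta> C) (call_cost \<gamma> c \<delta> C cost) =
     (if sure_run \<gamma> c \<delta> C = {} then 0 else cost (Max (sure_run \<gamma> c \<delta> C))) +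
     (\<Sum>k\<in>{k_min c..k_max \<delta>} - sure_run \<gamma> c \<delta> C. level_prob \<gamma> C k * (cost k + cost (k - 1)))"
proof -
  note [simp] = integrable_measure_pmf_finite[OF finite_call_draw]
  have "measure_pmf.expectation (call_draw \<gamma> c \<delta> C) (\<lambda>b. of_bool (b k)) = level_prob \<gamma> C k"
    if "k \<in> {k_min c..k_max \<delta>}" for k
    using expectation_draw[OF that, of of_bool] by simp
  moreover have "measure_pmf.expectation (call_draw \<gamma> c \<delta> C)
      (\<lambda>b. \<Sum>k\<in>K. of_bool (b k) * (cost k + cost (k - 1))) =
      (\<Sum>k\<in>K. measure_pmf.expectation (call_draw \<gamma> c \<delta> C) (\<lambda>b. of_bool (b k)) * (cost k + cost (k - 1)))"
    for K
    by (simp only: Bochner_Integration.integral_sum integral_mult_left_zero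
        integrable_measure_pmf_finite[OF finite_call_draw])
  ultimately show ?thesis
    unfolding call_cost_def by (subst Bochner_Integration.integral_add) (auto simp del: sum_of_bool_mult_eq)
qed

end

text \<open>The mean of the oracle telescopes to the finest level. If \<open>c\<close> is so small that there is no level
  at all, the oracle is \<open>0\<close>, and the accuracy of the constant \<open>0\<close> is already \<open>\<delta>\<close>.\<close>

lemma ml_gradient_bias:
  assumes "C > 0" "\<delta> > 0"
    and hierarchy: "dyadic_hierarchy \<gamma> c f A cost" and base: "zero_accurate c f y"
  shows "norm (measure_pmf.expectation (call_draw \<gamma> c \<delta> C) (\<lambda>b. ml_gradient \<gamma> c \<delta> C A b y) - f y) \<le> \<delta>"
proof -
  have telescope: "(\<Sum>k\<in>{m..n}. g k - g (k - 1)) = (if m \<le> n then g n - g (m - 1) else 0)"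
    for g :: "int \<Rightarrow> 'a" and m n
  proof (cases "m \<le> n")
    case True
    then show ?thesis
    proof (induction n rule: int_ge_induct)
      case (step n)
      then have "{m..n + 1} = insert (n + 1) {m..n}" by auto
      then show ?case using step by simp
    qed auto
  qed auto
  show ?thesis
  proof (cases "k_min c \<le> k_max \<delta>")
    case True
    then have "norm (A (k_max \<delta>) y - f y) \<le> 2 powr (- of_int (k_max \<delta>))"
      using hierarchy by (simp add: dyadic_hierarchy_def)
    then show ?thesis
      using True k_max_bounds(1)[OF \<open>\<delta> > 0\<close>]
      unfolding expectation_ml_gradient[OF \<open>C > 0\<close>] telescope[of "\<lambda>k. zero_base c A k y"]
      by (simp add: zero_base_def)
  next
    case False
    then have "norm (f y) \<le> 2 powr (- of_int (k_min c - 1))"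
      using base by (simp add: zero_accurate_def)
    also have "\<dots> \<le> 2 powr (- of_int (k_max \<delta>))"
      using False by simp
    finally show ?thesis
      using False k_max_bounds(1)[OF \<open>\<delta> > 0\<close>]
      unfolding expectation_ml_gradient[OF \<open>C > 0\<close>] telescope[of "\<lambda>k. zero_base c A k y"]
      by simp
  qed
qed

lemma variance_guaranteed_imp:
  fixes f :: "'a::euclidean_space \<Rightarrow> 'a"
  assumes "variance_guaranteed TYPE('a) \<gamma> c \<delta> \<sigma> C"
    and "dyadic_hierarchy \<gamma> c f A cost" "zero_accurate c f y"
  shows "oracle_variance \<gamma> c \<delta> C A y \<le> \<sigma>\<^sup>2"
proof -
  have "\<forall>k. norm (zero_base c A k y - f y) \<le> 2 powr (- of_int k)"
    using assms(2,3) by (auto simp: zero_base_def dyadic_hierarchy_def zero_accurate_def)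
  then show ?thesis
    using assms(1) unfolding variance_guaranteed_def by blast
qed

section \<open>Existence of the optimal constant\<close>

lemma level_prob_mono: "C \<le> C' \<Longrightarrow> level_prob \<gamma> C k \<le> level_prob \<gamma> C' k"
  unfolding level_prob_def by (intro min.mono mult_right_mono) auto

lemma oracle_variance_antimono:
  assumes "0 < C" "C \<le> C'"
  shows "oracle_variance \<gamma> c \<delta> C' A y \<le> oracle_variance \<gamma> c \<delta> C A y"
proof -
  have "1 / level_prob \<gamma> C' k \<le> 1 / level_prob \<gamma> C k" for k
    using level_prob_mono[OF assms(2), of \<gamma> k] level_prob_pos[OF assms(1), of \<gamma> k]
    by (simp add: frac_le)
  then show ?thesis
    using assms by (simp add: oracle_variance_eq) (intro sum_mono mult_right_mono, auto)
qed

lemma variance_guaranteed_mono: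
  assumes "variance_guaranteed TYPE('a::euclidean_space) \<gamma> c \<delta> \<sigma> C" "0 < C" "C \<le> C'"
  shows "variance_guaranteed TYPE('a) \<gamma> c \<delta> \<sigma> C'"
  using assms oracle_variance_antimono[OF assms(2,3)]
  unfolding variance_guaranteed_def by (meson order.trans)

text \<open>Together with monotonicity this makes the set of admissible constants closed from below, since
  the variance of every single family is continuous in the constant.\<close>

lemma variance_guaranteed_limit:
  assumes "0 < C" and above: "\<And>C'. C < C' \<Longrightarrow> variance_guaranteed TYPE('a::euclidean_space) \<gamma> c \<delta> \<sigma> C'"
  shows "variance_guaranteed TYPE('a) \<gamma> c \<delta> \<sigma> C"
  unfolding variance_guaranteed_def
proof (intro allI impI)
  fix f :: "'a \<Rightarrow> 'a" and A y
  assume acc: "\<forall>k. norm (zero_base c A k y - f y) \<le> 2 powr (- of_int k)"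
  define V where "V = (\<lambda>C. \<Sum>k\<in>{k_min c..k_max \<delta>}. (1 / level_prob \<gamma> C k - 1) *
        (norm (zero_base c A k y - zero_base c A (k - 1) y))\<^sup>2)"
  have "((\<lambda>C. level_prob \<gamma> C k) \<longlongrightarrow> level_prob \<gamma> C k) (at_right C)" for k
    unfolding level_prob_def by (intro tendsto_intros)
  moreover have "level_prob \<gamma> C k \<noteq> 0" for k
    using level_prob_pos[OF \<open>0 < C\<close>, of \<gamma> k] by simp
  ultimately have "(V \<longlongrightarrow> V C) (at_right C)"
    unfolding V_def by (intro tendsto_intros)
  moreover have "\<forall>\<^sub>F C' in at_right C. V C' \<le> \<sigma>\<^sup>2"
    unfolding eventually_at_right_field
  proof (intro exI[of _ "C + 1"] conjI allI impI)
    fix C' assume C': "C < C'"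
    then have "oracle_variance \<gamma> c \<delta> C' A y \<le> \<sigma>\<^sup>2"
      using above acc unfolding variance_guaranteed_def by blast
    then show "V C' \<le> \<sigma>\<^sup>2"
      using C' \<open>0 < C\<close> by (simp add: V_def oracle_variance_eq)
  qed simp
  ultimately have "V C \<le> \<sigma>\<^sup>2"
    by (intro tendsto_upperbound) auto
  then show "oracle_variance \<gamma> c \<delta> C A y \<le> \<sigma>\<^sup>2"
    using \<open>0 < C\<close> by (simp add: V_def oracle_variance_eq)
qed

text \<open>Admissible constants stay away from \<open>0\<close>: in the family all of whose levels are one nonzero vector,
  the coarsest increment alone has a variance that blows up as its probability vanishes.\<close>

lemma variance_guaranteed_lower_bound:
  assumes "k_min c \<le> k_max \<delta>"
  shows "\<exists>b>0. \<forall>C>0. variance_guaranteed TYPE('a::euclidean_space) \<gamma> c \<delta> \<sigma> C \<longrightarrow> b \<le> C"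
proof -
  define r where "r = 2 powr (- real_of_int (k_min c))"
  have "r > 0" by (simp add: r_def)
  obtain e :: 'a where "e \<in> Basis"
    using nonempty_Basis by blast
  define v where "v = r *\<^sub>R e"
  have nv: "norm v = r"
    using \<open>e \<in> Basis\<close> \<open>r > 0\<close> by (simp add: v_def)
  define A :: "int \<Rightarrow> 'a \<Rightarrow> 'a" where "A = (\<lambda>k _. v)"
  have acc: "norm (zero_base c A k 0 - v) \<le> 2 powr (- of_int k)" for k
    using nv by (simp add: zero_base_def A_def r_def)
  define a where "a = 2 powr (- (1 + \<gamma> / 2) * real_of_int (k_min c))"
  have "a > 0" by (simp add: a_def)
  have "1 / ((\<sigma>\<^sup>2 / r\<^sup>2 + 1) * a) \<le> C"
    if C: "C > 0" "variance_guaranteed TYPE('a) \<gamma> c \<delta> \<sigma> C" for C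
  proof -
    let ?p = "level_prob \<gamma> C (k_min c)"
    have p: "?p > 0" "?p \<le> C * a"
      using level_prob_pos[OF C(1)] by (auto simp: level_prob_def a_def)
    have "(1 / ?p - 1) * r\<^sup>2 =
        (1 / ?p - 1) * (norm (zero_base c A (k_min c) 0 - zero_base c A (k_min c - 1) 0))\<^sup>2"
      by (simp add: zero_base_def A_def nv)
    also have "\<dots> \<le> oracle_variance \<gamma> c \<delta> C A 0"
      unfolding oracle_variance_eq[OF C(1)]
      using assms level_prob_le_1[of \<gamma> C] level_prob_pos[OF C(1)]
      by (intro member_le_sum[where f = "\<lambda>k. (1 / level_prob \<gamma> C k - 1) *
            (norm (zero_base c A k 0 - zero_base c A (k - 1) 0))\<^sup>2"]) auto
    also have "\<dots> \<le> \<sigma>\<^sup>2"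
      using C(2) acc unfolding variance_guaranteed_def
      by (auto elim!: allE[of _ "\<lambda>_. v"] allE[of _ A] allE[of _ 0])
    finally have "1 / ?p \<le> \<sigma>\<^sup>2 / r\<^sup>2 + 1"
      using \<open>r > 0\<close> by (simp add: field_simps)
    then have "1 \<le> (\<sigma>\<^sup>2 / r\<^sup>2 + 1) * ?p"
      using p by (simp add: divide_le_eq)
    also have "\<dots> \<le> (\<sigma>\<^sup>2 / r\<^sup>2 + 1) * (C * a)"
      using p(2) by (intro mult_left_mono) auto
    finally show ?thesis
      using \<open>a > 0\<close> by (simp add: divide_le_eq add_nonneg_pos mult_ac)
  qed
  moreover have "1 / ((\<sigma>\<^sup>2 / r\<^sup>2 + 1) * a) > 0"
    using \<open>a > 0\<close> by (simp add: add_nonneg_pos)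
  ultimately show ?thesis
    by blast
qed

text \<open>An increment has norm at most \<open>2 powr (- k) + 2 powr (- (k - 1)) = 3 * 2 powr (- k)\<close>, which is the
  origin of the factor 9; surely drawn levels do not contribute.\<close>

lemma variance_guaranteedI:
  assumes "\<gamma> > 0" "C > 0"
    and small: "9 * (\<Sum>k | k \<in> {k_min c..k_max \<delta>} \<and> C < 2 powr ((1 + \<gamma> / 2) * of_int k).
        2 powr ((\<gamma> / 2 - 1) * of_int k)) \<le> \<sigma>\<^sup>2 * C"
  shows "variance_guaranteed TYPE('a::euclidean_space) \<gamma> c \<delta> \<sigma> C"
  unfolding variance_guaranteed_def
proof (intro allI impI)
  fix f :: "'a \<Rightarrow> 'a" and A y
  assume acc: "\<forall>k. norm (zero_base c A k y - f y) \<le> 2 powr (- of_int k)"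
  let ?K = "{k_min c..k_max \<delta>}"
  define N where "N = {k \<in> ?K. C < 2 powr ((1 + \<gamma> / 2) * of_int k)}"
  define d where "d = (\<lambda>k. norm (zero_base c A k y - zero_base c A (k - 1) y))"
  have d: "d k \<le> 3 * 2 powr (- of_int k)" for k
  proof -
    have "d k \<le> norm (zero_base c A k y - f y) + norm (zero_base c A (k - 1) y - f y)"
      unfolding d_def by (metis norm_triangle_ineq4 diff_diff_eq2 diff_add_cancel)
    also have "\<dots> \<le> 2 powr (- of_int k) + 2 powr (- of_int (k - 1))"
      using acc by (intro add_mono) blast+
    also have "\<dots> = 3 * 2 powr (- of_int k)"
      by (simp add: powr_diff powr_add powr_minus field_simps)
    finally show ?thesis .
  qed
  have zero: "(1 / level_prob \<gamma> C k - 1) * (d k)\<^sup>2 = 0" if "k \<in> ?K - N" for k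
    using that level_prob_eq_1_iff[of \<gamma> C k] by (auto simp: N_def)
  have summand: "(1 / level_prob \<gamma> C k - 1) * (d k)\<^sup>2 \<le> 9 * (2 powr ((\<gamma> / 2 - 1) * of_int k) / C)"
    if "k \<in> N" for k
  proof -
    have "C * 2 powr (- (1 + \<gamma> / 2) * of_int k) \<le> 1"
      using that by (simp add: N_def powr_minus powr_minus[of 2 "(1 + \<gamma> / 2) * of_int k", symmetric] field_simps)
    then have p: "1 / level_prob \<gamma> C k = 2 powr ((1 + \<gamma> / 2) * of_int k) / C"
      using \<open>C > 0\<close> by (simp add: level_prob_def min_def powr_minus field_simps)
    have "(1 / level_prob \<gamma> C k - 1) * (d k)\<^sup>2 \<le> 1 / level_prob \<gamma> C k * (3 * 2 powr (- of_int k))\<^sup>2"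
      using d[of k] level_prob_pos[OF \<open>C > 0\<close>, of \<gamma> k]
      by (intro mult_mono power_mono) (auto simp: d_def)
    also have "\<dots> = 9 * (2 powr ((1 + \<gamma> / 2) * of_int k + - of_int k + - of_int k) / C)"
      unfolding p powr_add by (simp add: power2_eq_square)
    also have "(1 + \<gamma> / 2) * of_int k + - of_int k + - of_int k = (\<gamma> / 2 - 1) * of_int k"
      by (simp add: algebra_simps)
    finally show ?thesis .
  qed
  have "oracle_variance \<gamma> c \<delta> C A y = (\<Sum>k\<in>?K. (1 / level_prob \<gamma> C k - 1) * (d k)\<^sup>2)"
    unfolding d_def by (rule oracle_variance_eq[OF \<open>C > 0\<close>])
  also have "\<dots> = (\<Sum>k\<in>N. (1 / level_prob \<gamma> C k - 1) * (d k)\<^sup>2)"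
    using zero by (intro sum.mono_neutral_right) (auto simp: N_def)
  also have "\<dots> \<le> (\<Sum>k\<in>N. 9 * (2 powr ((\<gamma> / 2 - 1) * of_int k) / C))"
    by (intro sum_mono summand)
  also have "\<dots> = 9 * (\<Sum>k\<in>N. 2 powr ((\<gamma> / 2 - 1) * of_int k)) / C"
    by (simp add: sum_distrib_left sum_divide_distrib)
  also have "\<dots> \<le> \<sigma>\<^sup>2"
    using small \<open>C > 0\<close> by (simp add: N_def divide_le_eq)
  finally show "oracle_variance \<gamma> c \<delta> C A y \<le> \<sigma>\<^sup>2" .
qed

text \<open>The compute increases with the constant as long as no further level becomes sure. When one does,
  the compute drops, because the sure levels are charged as a single evaluation.\<close>

lemma guaranteed_compute_mono_same_run:
  assumes "0 < C" "C \<le> C'" and run: "sure_run \<gamma> c \<delta> C = sure_run \<gamma> c \<delta> C'"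
  shows "guaranteed_compute \<gamma> c \<delta> C \<le> guaranteed_compute \<gamma> c \<delta> C'"
proof -
  have "0 < C'" using assms by simp
  show ?thesis
    unfolding guaranteed_compute_def expectation_call_cost[OF \<open>0 < C\<close>]
      expectation_call_cost[OF \<open>0 < C'\<close>] run
    using \<open>C \<le> C'\<close> by (intro add_left_mono sum_mono mult_right_mono level_prob_mono) auto
qed

text \<open>Although the compute is not monotone, a minimum is attained. Lowering an admissible constant
  to the next threshold at which the sure run changes, or to the least admissible constant, keeps the
  sure run and does not increase the compute, so it suffices to minimise over these finitely many
  candidates.\<close>

lemma optimal_constant_exists:
  assumes "\<gamma> > 0"
  shows "\<exists>C. optimal_constant TYPE('a::euclidean_space) \<gamma> c \<delta> \<sigma> C"
proof (cases "k_min c \<le> k_max \<delta>")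
  case False
  then have "variance_guaranteed TYPE('a) \<gamma> c \<delta> \<sigma> 1"
    by (simp add: variance_guaranteed_def oracle_variance_eq)
  moreover have "guaranteed_compute \<gamma> c \<delta> C = 0" if "C > 0" for C
    using that False by (simp add: guaranteed_compute_def expectation_call_cost sure_run_def)
  ultimately have "optimal_constant TYPE('a) \<gamma> c \<delta> \<sigma> 1"
    unfolding optimal_constant_def by auto
  then show ?thesis ..
next
  case True
  define thr where "thr = (\<lambda>k. 2 powr ((1 + \<gamma> / 2) * real_of_int k))"
  have thr: "2 powr ((1 + \<gamma> / 2) * of_int k) = thr k" for k
    by (simp add: thr_def)
  define F where "F = {C. C > 0 \<and> variance_guaranteed TYPE('a) \<gamma> c \<delta> \<sigma> C}"
  have "variance_guaranteed TYPE('a) \<gamma> c \<delta> \<sigma> (thr (k_max \<delta>))"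
  proof (rule variance_guaranteedI)
    have "{k. k \<in> {k_min c..k_max \<delta>} \<and> thr (k_max \<delta>) < thr k} = {}"
      using assms by (auto simp: thr_def)
    then show "9 * (\<Sum>k | k \<in> {k_min c..k_max \<delta>} \<and> thr (k_max \<delta>) < 2 powr ((1 + \<gamma> / 2) * of_int k).
        2 powr ((\<gamma> / 2 - 1) * of_int k)) \<le> \<sigma>\<^sup>2 * thr (k_max \<delta>)"
      unfolding thr by (simp only: sum.empty) (simp add: thr_def)
  qed (use assms in \<open>simp_all add: thr_def\<close>)
  then have "thr (k_max \<delta>) \<in> F"
    by (simp add: F_def thr_def)
  obtain b where b: "b > 0" "\<And>C. C \<in> F \<Longrightarrow> b \<le> C"
    using variance_guaranteed_lower_bound[OF True, of \<gamma> \<sigma>, where 'a = 'a] by (auto simp: F_def)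
  \<comment> \<open>The least admissible constant; the candidates are \<open>C0\<close> and the thresholds above it.\<close>
  define C0 where "C0 = Inf F"
  have bdd: "bdd_below F"
    using b(2) by (meson bdd_belowI)
  have "C0 \<ge> b"
    unfolding C0_def using \<open>thr (k_max \<delta>) \<in> F\<close> b(2) by (intro cInf_greatest) auto
  then have "C0 > 0"
    using b(1) by simp
  have C0_le: "C0 \<le> C" if "C \<in> F" for C
    unfolding C0_def by (rule cInf_lower[OF that bdd])
  have "C \<in> F" if C: "C0 < C" for C
  proof -
    obtain C' where "C' \<in> F" "C' < C"
      using C \<open>thr (k_max \<delta>) \<in> F\<close> cInf_lessD[of F C] by (auto simp: C0_def)
    then show ?thesis
      by (auto simp: F_def intro: variance_guaranteed_mono)
  qed
  then have "C0 \<in> F"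
    using \<open>C0 > 0\<close> variance_guaranteed_limit[of C0, where 'a = 'a] by (auto simp: F_def)
  define cand where "cand = insert C0 {t \<in> thr ` {k_min c..k_max \<delta>}. C0 \<le> t}"
  have cand: "finite cand" "C0 \<in> cand" "cand \<subseteq> F" "\<And>C. C \<in> cand \<Longrightarrow> C0 \<le> C"
    using \<open>C0 \<in> F\<close> variance_guaranteed_mono[of \<gamma> c \<delta> \<sigma> C0, where 'a = 'a] \<open>C0 > 0\<close>
    by (auto simp: cand_def F_def)
  obtain C1 where C1: "C1 \<in> cand" "\<And>C. C \<in> cand \<Longrightarrow> guaranteed_compute \<gamma> c \<delta> C1 \<le> guaranteed_compute \<gamma> c \<delta> C"
    using ex_min_if_finite[of "guaranteed_compute \<gamma> c \<delta> ` cand"] cand(1,2) by (auto simp: not_less)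
  have "guaranteed_compute \<gamma> c \<delta> C1 \<le> guaranteed_compute \<gamma> c \<delta> C" if "C \<in> F" for C
  proof -
    define D where "D = Max {t \<in> cand. t \<le> C}"
    have fin: "finite {t \<in> cand. t \<le> C}"
      using cand(1) by auto
    have "D \<in> {t \<in> cand. t \<le> C}"
      unfolding D_def using C0_le[OF that] cand(1,2) by (intro Max_in) auto
    then have D: "D \<in> cand" "D \<le> C" "C0 \<le> D"
      using cand(4) by auto
    have "thr k \<le> D" if "k \<in> {k_min c..k_max \<delta>}" "thr k \<le> C" for k
    proof (cases "C0 \<le> thr k")
      case True
      then show ?thesis
        unfolding D_def using that by (intro Max_ge[OF fin]) (auto simp: cand_def)
    qed (use D in auto)
    then have "sure_run \<gamma> c \<delta> D = sure_run \<gamma> c \<delta> C"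
      unfolding sure_run_eq[OF assms] thr using D(2) by auto
    then have "guaranteed_compute \<gamma> c \<delta> D \<le> guaranteed_compute \<gamma> c \<delta> C"
      using guaranteed_compute_mono_same_run D \<open>C0 > 0\<close> by force
    then show ?thesis
      using C1(2)[OF D(1)] by simp
  qed
  then have "optimal_constant TYPE('a) \<gamma> c \<delta> \<sigma> C1"
    using C1(1) cand(3) by (auto simp: optimal_constant_def F_def)
  then show ?thesis ..
qed

lemma ml_const_optimal:
  assumes "\<gamma> > 0"
  shows "optimal_constant TYPE('a::euclidean_space) \<gamma> c \<delta> \<sigma> (ml_const TYPE('a) \<gamma> c \<delta> \<sigma>)"
  unfolding ml_const_def by (rule someI_ex[OF optimal_constant_exists[OF assms]])

section \<open>Expected compute of one call\<close>

text \<open>The factor 2 accounts for the coarser of the two levels whose difference is an increment.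
  The cost \<open>2 powr (\<gamma> * k)\<close> times the probability \<open>2 powr (- (1 + \<gamma> / 2) * k)\<close> leaves the same exponent
  \<open>\<gamma> / 2 - 1\<close> that governs the variance.\<close>

lemma guaranteed_compute_le:
  assumes "\<gamma> > 0" "C > 0"
    and X: "X \<ge> 0" "\<And>k. k \<in> sure_run \<gamma> c \<delta> C \<Longrightarrow> 2 powr of_int k \<le> X"
  shows "guaranteed_compute \<gamma> c \<delta> C \<le> c powr \<gamma> * X powr \<gamma> + 2 * c powr \<gamma> * C *
      (\<Sum>k\<in>{k_min c..k_max \<delta>} - sure_run \<gamma> c \<delta> C. 2 powr ((\<gamma> / 2 - 1) * of_int k))"
proof -
  let ?S = "sure_run \<gamma> c \<delta> C" and ?cost = "\<lambda>k. c powr \<gamma> * 2 powr (\<gamma> * of_int k)"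
  have "(if ?S = {} then 0 else ?cost (Max ?S)) \<le> c powr \<gamma> * X powr \<gamma>"
  proof (cases "?S = {}")
    case False
    then have "Max ?S \<in> ?S"
      by (intro Max_in finite_subset[of ?S "{k_min c..k_max \<delta>}"]) (auto simp: sure_run_def)
    then have "(2 powr of_int (Max ?S)) powr \<gamma> \<le> X powr \<gamma>"
      using X assms(1) by (intro powr_mono2) auto
    then have "c powr \<gamma> * 2 powr (\<gamma> * of_int (Max ?S)) \<le> c powr \<gamma> * X powr \<gamma>"
      by (intro mult_left_mono) (simp_all add: powr_powr mult.commute)
    then show ?thesis
      using False by simp
  qed (use X in auto)
  moreover have "level_prob \<gamma> C k * (?cost k + ?cost (k - 1)) \<le>
      2 * c powr \<gamma> * C * 2 powr ((\<gamma> / 2 - 1) * of_int k)" for k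
  proof -
    have "?cost (k - 1) \<le> ?cost k"
      using assms(1) by (intro mult_left_mono) auto
    then have "level_prob \<gamma> C k * (?cost k + ?cost (k - 1)) \<le>
        (C * 2 powr (- (1 + \<gamma> / 2) * of_int k)) * (2 * ?cost k)"
      using assms(2) by (intro mult_mono) (auto simp: level_prob_def)
    also have "\<dots> = 2 * c powr \<gamma> * C * 2 powr (- (1 + \<gamma> / 2) * of_int k + \<gamma> * of_int k)"
      by (simp add: powr_add)
    also have "- (1 + \<gamma> / 2) * of_int k + \<gamma> * of_int k = (\<gamma> / 2 - 1) * of_int k"
      by (simp add: algebra_simps)
    finally show ?thesis .
  qed
  ultimately show ?thesis
    unfolding guaranteed_compute_def expectation_call_cost[OF \<open>C > 0\<close>] sum_distrib_left
    by (intro add_mono sum_mono)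
qed

definition optimal_call_cost ::
    "'a::euclidean_space itself \<Rightarrow> real \<Rightarrow> real \<Rightarrow> real \<Rightarrow> real \<Rightarrow> (int \<Rightarrow> real) \<Rightarrow> real" where
  "optimal_call_cost TYPE('a) \<gamma> c \<delta> \<sigma> cost =
     measure_pmf.expectation (call_draw \<gamma> c \<delta> (ml_const TYPE('a) \<gamma> c \<delta> \<sigma>))
       (call_cost \<gamma> c \<delta> (ml_const TYPE('a) \<gamma> c \<delta> \<sigma>) cost)"

text \<open>Comparison of the optimal constant with \<open>M powr (1 + \<gamma> / 2)\<close>, for which exactly the levels with
  \<open>2 powr k \<le> M\<close> are sure. The bound \<open>2 / \<delta>\<close> in the minimum limits the finest level, in case \<open>M\<close> exceeds
  what the hierarchy needs.\<close>

lemma optimal_call_cost_le: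
  assumes "\<gamma> > 0" "\<delta> > 0" "M > 0"
    and cost: "\<And>k. cost k \<le> c powr \<gamma> * 2 powr (\<gamma> * of_int k)"
    and S: "(\<Sum>k | k \<in> {k_min c..k_max \<delta>} \<and> M < 2 powr of_int k. 2 powr ((\<gamma> / 2 - 1) * of_int k)) \<le> S"
    and feasible: "9 * S \<le> \<sigma>\<^sup>2 * M powr (1 + \<gamma> / 2)"
  shows "optimal_call_cost TYPE('a::euclidean_space) \<gamma> c \<delta> \<sigma> cost \<le>
      c powr \<gamma> * (min M (2 / \<delta>)) powr \<gamma> + 2 * c powr \<gamma> * M powr (1 + \<gamma> / 2) * S"
proof -
  define C where "C = ml_const TYPE('a) \<gamma> c \<delta> \<sigma>"
  define C' where "C' = M powr (1 + \<gamma> / 2)"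
  have "C' > 0"
    using assms(3) by (simp add: C'_def)
  have iff: "2 powr ((1 + \<gamma> / 2) * of_int k) \<le> C' \<longleftrightarrow> 2 powr of_int k \<le> M" for k
  proof -
    have "(2 powr of_int k) powr (1 + \<gamma> / 2) \<le> M powr (1 + \<gamma> / 2) \<longleftrightarrow> 2 powr of_int k \<le> M"
    proof
      assume "(2 powr of_int k) powr (1 + \<gamma> / 2) \<le> M powr (1 + \<gamma> / 2)"
      then show "2 powr of_int k \<le> M"
        using assms(1,3) powr_less_mono2[of "1 + \<gamma> / 2" M "2 powr of_int k"] by argo
    next
      assume "2 powr of_int k \<le> M"
      then show "(2 powr of_int k) powr (1 + \<gamma> / 2) \<le> M powr (1 + \<gamma> / 2)"
        using assms(1) by (intro powr_mono2) auto
    qed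
    then show ?thesis
      by (simp add: C'_def powr_powr mult.commute)
  qed
  have sure: "sure_run \<gamma> c \<delta> C' = {k \<in> {k_min c..k_max \<delta>}. 2 powr of_int k \<le> M}"
    unfolding sure_run_eq[OF assms(1)] iff ..
  have rest: "{k_min c..k_max \<delta>} - sure_run \<gamma> c \<delta> C' =
      {k. k \<in> {k_min c..k_max \<delta>} \<and> M < 2 powr of_int k}"
    unfolding sure by auto
  have "variance_guaranteed TYPE('a) \<gamma> c \<delta> \<sigma> C'"
  proof (rule variance_guaranteedI)
    have levels: "{k. k \<in> {k_min c..k_max \<delta>} \<and> C' < 2 powr ((1 + \<gamma> / 2) * of_int k)} =
        {k. k \<in> {k_min c..k_max \<delta>} \<and> M < 2 powr of_int k}"
      unfolding not_le[symmetric] iff ..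
    show "9 * (\<Sum>k | k \<in> {k_min c..k_max \<delta>} \<and> C' < 2 powr ((1 + \<gamma> / 2) * of_int k).
        2 powr ((\<gamma> / 2 - 1) * of_int k)) \<le> \<sigma>\<^sup>2 * C'"
      unfolding levels using feasible S by (simp add: C'_def)
  qed (use assms(1) \<open>C' > 0\<close> in auto)
  then have "C > 0" and opt: "guaranteed_compute \<gamma> c \<delta> C \<le> guaranteed_compute \<gamma> c \<delta> C'"
    using ml_const_optimal[OF assms(1), of c \<delta> \<sigma>, where 'a = 'a] \<open>C' > 0\<close>
    unfolding optimal_constant_def C_def by blast+
  have "optimal_call_cost TYPE('a) \<gamma> c \<delta> \<sigma> cost \<le> guaranteed_compute \<gamma> c \<delta> C"
    unfolding optimal_call_cost_def guaranteed_compute_def C_def[symmetric]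
      expectation_call_cost[OF \<open>C > 0\<close>]
    using cost[of "k - 1" for k] cost level_prob_pos[OF \<open>C > 0\<close>, of \<gamma>]
    by (intro add_mono sum_mono mult_left_mono) (auto intro: less_imp_le)
  also note opt
  also have "guaranteed_compute \<gamma> c \<delta> C' \<le> c powr \<gamma> * (min M (2 / \<delta>)) powr \<gamma> + 2 * c powr \<gamma> * C' *
      (\<Sum>k\<in>{k_min c..k_max \<delta>} - sure_run \<gamma> c \<delta> C'. 2 powr ((\<gamma> / 2 - 1) * of_int k))"
  proof (rule guaranteed_compute_le[OF assms(1) \<open>C' > 0\<close>])
    fix k assume "k \<in> sure_run \<gamma> c \<delta> C'"
    then have "2 powr of_int k \<le> M" "2 powr of_int k \<le> 2 powr real_of_int (k_max \<delta>)"
      unfolding sure by auto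
    then show "2 powr of_int k \<le> min M (2 / \<delta>)"
      using k_max_bounds(2)[OF \<open>\<delta> > 0\<close>] by (intro min.boundedI; linarith)
  qed (use assms(2,3) in auto)
  also have "\<dots> \<le> c powr \<gamma> * (min M (2 / \<delta>)) powr \<gamma> + 2 * c powr \<gamma> * C' * S"
    unfolding rest using S \<open>C' > 0\<close> by (intro add_left_mono mult_left_mono) auto
  finally show ?thesis
    by (simp add: C'_def)
qed

text \<open>With \<open>M = 2 / \<delta>\<close> every level is sure, and a call is one evaluation of the finest algorithm.\<close>

lemma optimal_call_cost_le_finest:
  assumes "\<gamma> > 0" "\<delta> > 0"
    and cost: "\<And>k. cost k \<le> c powr \<gamma> * 2 powr (\<gamma> * of_int k)"
  shows "optimal_call_cost TYPE('a::euclidean_space) \<gamma> c \<delta> \<sigma> cost \<le> c powr \<gamma> * (2 / \<delta>) powr \<gamma>"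
proof -
  have "2 powr of_int k \<le> 2 / \<delta>" if "k \<le> k_max \<delta>" for k
    using that k_max_bounds(2)[OF \<open>\<delta> > 0\<close>]
    by (meson less_eq_real_def of_int_le_iff one_le_numeral order.trans powr_mono)
  then have none: "{k. k \<in> {k_min c..k_max \<delta>} \<and> 2 / \<delta> < 2 powr of_int k} = {}"
    by fastforce
  show ?thesis
    using optimal_call_cost_le[OF assms(1,2) _ cost, where M = "2 / \<delta>" and S = 0 and 'a = 'a, unfolded none]
      assms by simp
qed

lemma sum_dyadic_le_coarsest:
  assumes "finite K" "b > 0" "M > 0" and K: "\<And>k. k \<in> K \<Longrightarrow> M \<le> (2 :: real) powr of_int k"
  shows "(\<Sum>k\<in>K. 2 powr (- b * of_int k)) \<le> M powr (- b) / (1 - 2 powr (- b))"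
proof (cases "K = {}")
  case True
  have "2 powr (- b) \<le> (1 :: real)"
    using \<open>b > 0\<close> powr_mono[of "- b" 0 "2 :: real"] by simp
  then show ?thesis using True by simp
next
  case False
  define m where "m = Min K"
  have m: "m \<in> K" "\<And>k. k \<in> K \<Longrightarrow> m \<le> k"
    using False \<open>finite K\<close> by (auto simp: m_def)
  define r where "r = 2 powr (- b)"
  have r: "0 < r" "r < 1"
    using \<open>b > 0\<close> powr_less_mono[of "- b" 0 "2 :: real"] by (auto simp: r_def)
  have pow: "2 powr (- b * of_int (m + int j)) = 2 powr (- b * of_int m) * r ^ j" for j
    by (simp add: r_def powr_realpow[symmetric] powr_powr powr_add[symmetric] algebra_simps)
  have "K = (\<lambda>j. m + int j) ` (\<lambda>k. nat (k - m)) ` K"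
    using m(2) by (force simp: image_image)
  then have "(\<Sum>k\<in>K. 2 powr (- b * of_int k)) =
      (\<Sum>j\<in>(\<lambda>k. nat (k - m)) ` K. 2 powr (- b * of_int (m + int j)))"
    by (rule sum.reindex_cong[rotated]) (auto simp: inj_on_def)
  also have "\<dots> = 2 powr (- b * of_int m) * (\<Sum>j\<in>(\<lambda>k. nat (k - m)) ` K. r ^ j)"
    by (simp only: pow sum_distrib_left)
  also have "\<dots> \<le> 2 powr (- b * of_int m) * (1 / (1 - r))"
    using r \<open>finite K\<close>
    by (intro mult_left_mono) (auto intro!: sum_le_suminf simp: suminf_geometric[symmetric] summable_geometric)
  also have "\<dots> \<le> M powr (- b) * (1 / (1 - r))"
  proof (intro mult_right_mono)
    have "(2 powr of_int m) powr (- b) \<le> M powr (- b)"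
      using K[OF m(1)] assms by (intro powr_mono2') auto
    then show "2 powr (- b * of_int m) \<le> M powr (- b)"
      by (simp add: powr_powr mult.commute)
  qed (use r in auto)
  finally show ?thesis
    by (simp add: r_def)
qed

lemma sum_dyadic_le_finest:
  assumes "finite K" "b > 0" "N > 0" and K: "\<And>k. k \<in> K \<Longrightarrow> 2 powr of_int k \<le> (N :: real)"
  shows "(\<Sum>k\<in>K. 2 powr (b * of_int k)) \<le> N powr b / (1 - 2 powr (- b))"
proof -
  have "(\<Sum>k\<in>K. 2 powr (b * of_int k)) = (\<Sum>k\<in>uminus ` K. 2 powr (- b * of_int k))"
    by (simp add: sum.reindex)
  also have "\<dots> \<le> (1 / N) powr (- b) / (1 - 2 powr (- b))"
  proof (rule sum_dyadic_le_coarsest)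
    fix k assume "k \<in> uminus ` K"
    then show "1 / N \<le> 2 powr of_int k"
      using K[of "- k"] \<open>N > 0\<close> by (auto simp: powr_minus field_simps)
  qed (use assms in auto)
  also have "(1 / N) powr (- b) = N powr b"
    using \<open>N > 0\<close> by (simp add: powr_minus powr_divide)
  finally show ?thesis .
qed

lemma card_levels_le:
  assumes "M > 0" "\<delta> > 0"
  shows "real (card {k. k \<in> {k_min c..k_max \<delta>} \<and> M < 2 powr of_int k}) \<le> max 0 (log 2 (4 / (\<delta> * M)))"
proof -
  have "real_of_int (k_max \<delta>) \<le> log 2 (2 / \<delta>)"
    using k_max_bounds(2)[OF assms(2)] assms by (simp add: le_log_iff)
  have "{k. k \<in> {k_min c..k_max \<delta>} \<and> M < 2 powr of_int k} \<subseteq> {\<lfloor>log 2 M\<rfloor> + 1..k_max \<delta>}"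
  proof
    fix k assume k: "k \<in> {k. k \<in> {k_min c..k_max \<delta>} \<and> M < 2 powr of_int k}"
    then have "log 2 M < of_int k"
      using assms by (simp add: log_less_iff)
    then show "k \<in> {\<lfloor>log 2 M\<rfloor> + 1..k_max \<delta>}"
      using k by (auto, linarith)
  qed
  then have "real (card {k. k \<in> {k_min c..k_max \<delta>} \<and> M < 2 powr of_int k}) \<le> real (nat (k_max \<delta> - \<lfloor>log 2 M\<rfloor>))"
    using card_mono[of "{\<lfloor>log 2 M\<rfloor> + 1..k_max \<delta>}"] by fastforce
  also have "\<dots> \<le> max 0 (log 2 (2 / \<delta>) - log 2 M + 1)"
    using \<open>real_of_int (k_max \<delta>) \<le> log 2 (2 / \<delta>)\<close> by (simp add: le_max_iff_disj) linarith
  also have "log 2 (2 / \<delta>) - log 2 M + 1 = log 2 (4 / (\<delta> * M))"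
    using assms log_nat_power[of 2 2 2] by (simp add: log_divide log_mult)
  finally show ?thesis .
qed

text \<open>For \<open>\<gamma> > 2\<close> the finest level dominates, so the whole range of levels may enter \<open>S\<close>, and \<open>M\<close> is chosen
  to make the variance condition an equality.\<close>

lemma optimal_call_cost_le_steep:
  assumes "\<gamma> > 2" "\<delta> > 0" "\<sigma> > 0"
    and cost: "\<And>k. cost k \<le> c powr \<gamma> * 2 powr (\<gamma> * of_int k)"
  shows "optimal_call_cost TYPE('a::euclidean_space) \<gamma> c \<delta> \<sigma> cost \<le>
      27 * c powr \<gamma> * (2 / \<delta>) powr (\<gamma> - 2) / (\<sigma>\<^sup>2 * (1 - 2 powr (- \<bar>\<gamma> / 2 - 1\<bar>))\<^sup>2)"
proof -
  define b where "b = \<gamma> / 2 - 1"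
  have "b > 0" using assms by (simp add: b_def)
  define q where "q = 1 - 2 powr (- \<bar>b\<bar>)"
  have "q > 0"
    using \<open>b > 0\<close> powr_less_mono[of "- b" 0 "2 :: real"] by (simp add: q_def)
  define N where "N = 2 / \<delta>"
  have "N > 0" using assms by (simp add: N_def)
  define S where "S = N powr b / q"
  have "S > 0" using \<open>N > 0\<close> \<open>q > 0\<close> by (simp add: S_def)
  define M where "M = (9 * S / \<sigma>\<^sup>2) powr (1 / (1 + \<gamma> / 2))"
  have Ma: "M powr (1 + \<gamma> / 2) = 9 * S / \<sigma>\<^sup>2" and "M > 0"
    using assms \<open>S > 0\<close> by (simp_all add: M_def powr_powr)
  have le_N: "2 powr of_int k \<le> N" if "k \<le> k_max \<delta>" for k
  proof -
    have "2 powr of_int k \<le> 2 powr real_of_int (k_max \<delta>)"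
      using that by simp
    then show ?thesis
      using k_max_bounds(2)[OF \<open>\<delta> > 0\<close>] unfolding N_def by linarith
  qed
  have "(\<Sum>k | k \<in> {k_min c..k_max \<delta>} \<and> M < 2 powr of_int k. 2 powr (b * of_int k)) \<le> S"
    unfolding S_def q_def abs_of_pos[OF \<open>b > 0\<close>]
    by (rule sum_dyadic_le_finest[OF finite_subset[of _ "{k_min c..k_max \<delta>}"]])
       (use \<open>b > 0\<close> \<open>N > 0\<close> le_N in auto)
  then have "optimal_call_cost TYPE('a) \<gamma> c \<delta> \<sigma> cost \<le>
      c powr \<gamma> * (min M N) powr \<gamma> + 2 * c powr \<gamma> * M powr (1 + \<gamma> / 2) * S"
    unfolding b_def N_def using assms \<open>M > 0\<close> Ma by (intro optimal_call_cost_le) auto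
  \<comment> \<open>The sure run costs no more than the random levels: split off the exponent \<open>1 + \<gamma> / 2\<close>.\<close>
  also have "(min M N) powr \<gamma> \<le> M powr (1 + \<gamma> / 2) * S"
  proof -
    have "(min M N) powr \<gamma> = (min M N) powr (1 + \<gamma> / 2) * (min M N) powr b"
      by (simp add: b_def flip: powr_add)
    also have "\<dots> \<le> M powr (1 + \<gamma> / 2) * N powr b"
      using \<open>b > 0\<close> \<open>M > 0\<close> \<open>N > 0\<close> assms(1) by (intro mult_mono powr_mono2) auto
    also have "N powr b \<le> S"
      using \<open>q > 0\<close> \<open>N > 0\<close> by (simp add: S_def q_def field_simps)
    finally show ?thesis
      by (simp add: mult_left_mono)
  qed
  also have "c powr \<gamma> * (M powr (1 + \<gamma> / 2) * S) + 2 * c powr \<gamma> * M powr (1 + \<gamma> / 2) * S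
      = 27 * c powr \<gamma> * (N powr b * N powr b) / (\<sigma>\<^sup>2 * q\<^sup>2)"
    unfolding Ma S_def by (simp add: field_simps power2_eq_square)
  also have "N powr b * N powr b = N powr (\<gamma> - 2)"
    by (simp add: b_def flip: powr_add)
  finally show ?thesis
    by (simp add: N_def q_def b_def mult_left_mono)
qed

text \<open>For \<open>\<gamma> = 2\<close> all random levels contribute equally, and \<open>S\<close> is a bound \<open>x\<close> on their number. The constant
  itself depends on \<open>x\<close>, but \<open>x \<ge> 1\<close> already forces \<open>M \<ge> 3 / \<sigma>\<close>, which leaves at most
  \<open>1 + log 2 (\<sigma> / \<delta>)\<close> levels between \<open>M\<close> and \<open>1 / \<delta>\<close>.\<close>

lemma optimal_call_cost_le_critical:
  assumes "\<delta> > 0" "\<sigma> > 0"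
    and cost: "\<And>k. cost k \<le> c powr 2 * 2 powr (2 * of_int k)"
    and x: "x \<ge> 1" "x \<ge> 1 + log 2 (\<sigma> / \<delta>)"
  shows "optimal_call_cost TYPE('a::euclidean_space) 2 c \<delta> \<sigma> cost \<le> 27 * c powr 2 * x\<^sup>2 / \<sigma>\<^sup>2"
proof -
  define M where "M = 3 * sqrt x / \<sigma>"
  have "M > 0" and Ma: "M powr 2 = 9 * x / \<sigma>\<^sup>2"
    using assms by (simp_all add: M_def power_divide power_mult_distrib powr_numeral)
  have "4 / (\<delta> * M) \<le> 2 * \<sigma> / \<delta>"
  proof -
    have "2 \<le> 3 * sqrt x"
      using real_sqrt_ge_one[OF x(1)] by linarith
    then show ?thesis
      using assms x(1) by (simp add: M_def field_simps)
  qed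
  then have "log 2 (4 / (\<delta> * M)) \<le> log 2 (2 * (\<sigma> / \<delta>))"
    using assms \<open>M > 0\<close> by simp
  also have "\<dots> \<le> x"
    using assms by (subst log_mult) auto
  finally have "real (card {k. k \<in> {k_min c..k_max \<delta>} \<and> M < 2 powr of_int k}) \<le> x"
    using card_levels_le[OF \<open>M > 0\<close> assms(1), of c] x(1) by linarith
  then have "optimal_call_cost TYPE('a) 2 c \<delta> \<sigma> cost \<le>
      c powr 2 * (min M (2 / \<delta>)) powr 2 + 2 * c powr 2 * M powr (1 + 2 / 2) * x"
    using assms \<open>M > 0\<close> Ma by (intro optimal_call_cost_le) auto
  also have "(min M (2 / \<delta>)) powr 2 \<le> M powr 2"
    using \<open>M > 0\<close> assms by (intro powr_mono2) auto
  also have "M powr 2 \<le> M powr 2 * x"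
    using x(1) mult_left_mono[of 1 x "M powr 2"] by simp
  also have "c powr 2 * (M powr 2 * x) + 2 * c powr 2 * M powr (1 + 2 / 2) * x = 27 * c powr 2 * x\<^sup>2 / \<sigma>\<^sup>2"
    using Ma by (simp add: power2_eq_square)
  finally show ?thesis
    by (simp add: mult_left_mono)
qed

text \<open>For \<open>\<gamma> < 2\<close> the coarsest random level dominates, and this level sits at \<open>M\<close>. The variance condition
  \<open>9 * M powr (- (1 - \<gamma> / 2)) / q = \<sigma>\<^sup>2 * M powr (1 + \<gamma> / 2)\<close> then reads \<open>M\<^sup>2 = 9 / (\<sigma>\<^sup>2 * q)\<close>, so the
  compute is of order \<open>(c / \<sigma>) powr \<gamma>\<close>, independent of \<open>\<delta>\<close>.\<close>

lemma optimal_call_cost_le_flat: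
  assumes "0 < \<gamma>" "\<gamma> < 2" "\<delta> > 0" "\<sigma> > 0"
    and cost: "\<And>k. cost k \<le> c powr \<gamma> * 2 powr (\<gamma> * of_int k)"
  shows "optimal_call_cost TYPE('a::euclidean_space) \<gamma> c \<delta> \<sigma> cost \<le>
      27 * c powr \<gamma> * \<sigma> powr (- \<gamma>) / (1 - 2 powr (- \<bar>\<gamma> / 2 - 1\<bar>))\<^sup>2"
proof -
  define b where "b = 1 - \<gamma> / 2"
  have "b > 0" using assms by (simp add: b_def)
  define q where "q = 1 - 2 powr (- \<bar>\<gamma> / 2 - 1\<bar>)"
  have q_b: "q = 1 - 2 powr (- b)"
    using \<open>b > 0\<close> by (simp add: q_def b_def)
  have "0 < q" "q \<le> 1"
    using \<open>b > 0\<close> powr_less_mono[of "- b" 0 "2 :: real"] by (simp_all add: q_b)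
  define M where "M = 3 / (\<sigma> * sqrt q)"
  have "M > 0" and M2: "M powr 2 = 9 / (\<sigma>\<^sup>2 * q)"
    using assms \<open>q > 0\<close> by (simp_all add: M_def power_divide power_mult_distrib powr_numeral)
  define S where "S = M powr (- b) / q"
  have Ma: "M powr (1 + \<gamma> / 2) = M powr 2 * M powr (- b)"
    by (simp add: b_def flip: powr_add)
  have "(\<Sum>k | k \<in> {k_min c..k_max \<delta>} \<and> M < 2 powr of_int k. 2 powr (- b * of_int k)) \<le> S"
    unfolding S_def q_b
    by (rule sum_dyadic_le_coarsest[OF finite_subset[of _ "{k_min c..k_max \<delta>}"]])
       (use \<open>b > 0\<close> \<open>M > 0\<close> in auto)
  moreover have "\<gamma> / 2 - 1 = - b"
    by (simp add: b_def)
  moreover have "9 * S \<le> \<sigma>\<^sup>2 * M powr (1 + \<gamma> / 2)"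
    unfolding Ma M2 S_def using assms \<open>q > 0\<close> by (simp add: field_simps)
  ultimately have "optimal_call_cost TYPE('a) \<gamma> c \<delta> \<sigma> cost \<le>
      c powr \<gamma> * (min M (2 / \<delta>)) powr \<gamma> + 2 * c powr \<gamma> * M powr (1 + \<gamma> / 2) * S"
    using assms \<open>M > 0\<close> by (intro optimal_call_cost_le) auto
  also have "(min M (2 / \<delta>)) powr \<gamma> \<le> M powr \<gamma>"
    using \<open>M > 0\<close> assms by (intro powr_mono2) auto
  also have "M powr \<gamma> \<le> M powr \<gamma> / q"
    using \<open>q \<le> 1\<close> \<open>q > 0\<close> by (simp add: field_simps mult_left_le_one_le)
  also have "2 * c powr \<gamma> * M powr (1 + \<gamma> / 2) * S = 2 * c powr \<gamma> * (M powr \<gamma> / q)"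
  proof -
    have "M powr (1 + \<gamma> / 2) * M powr (- b) = M powr \<gamma>"
      by (simp add: b_def flip: powr_add)
    then show ?thesis by (simp add: S_def)
  qed
  also have "c powr \<gamma> * (M powr \<gamma> / q) + 2 * c powr \<gamma> * (M powr \<gamma> / q) = 3 * c powr \<gamma> * (M powr \<gamma> / q)"
    by simp
  also have "M powr \<gamma> / q \<le> 9 * \<sigma> powr (- \<gamma>) / q\<^sup>2"
  proof -
    have "M powr \<gamma> = 3 powr \<gamma> * \<sigma> powr (- \<gamma>) * q powr (- \<gamma> / 2)"
      using assms \<open>q > 0\<close>
      by (simp add: M_def powr_divide powr_mult powr_minus_divide powr_powr flip: powr_half_sqrt)
    also have "\<dots> \<le> 3 powr 2 * \<sigma> powr (- \<gamma>) * q powr (- 1)"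
    proof -
      have "3 powr \<gamma> \<le> (3 :: real) powr 2"
        using assms by (intro powr_mono) auto
      moreover have "q powr (- \<gamma> / 2) \<le> q powr (- 1)"
        using assms \<open>q > 0\<close> \<open>q \<le> 1\<close> by (intro powr_mono') auto
      ultimately show ?thesis
        by (intro mult_mono) auto
    qed
    finally show ?thesis
      using \<open>q > 0\<close> by (simp add: powr_minus_divide powr_numeral field_simps power2_eq_square)
  qed
  finally show ?thesis
    by (simp add: q_def mult_left_mono)
qed

section \<open>Smooth convex functions\<close>

lemma GDERIV_along_line:
  assumes "\<And>y. GDERIV L y :> f y"
  shows "((\<lambda>t. L (y + t *\<^sub>R h)) has_real_derivative f (y + t *\<^sub>R h) \<bullet> h) (at t)"
proof -
  have "((\<lambda>t. y + t *\<^sub>R h) has_derivative (\<lambda>s. s *\<^sub>R h)) (at t)"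
    by (auto intro!: derivative_eq_intros)
  moreover have "(L has_derivative (\<lambda>v. v \<bullet> f (y + t *\<^sub>R h))) (at (y + t *\<^sub>R h))"
    using assms by (simp add: gderiv_def)
  ultimately have "((\<lambda>t. L (y + t *\<^sub>R h)) has_derivative (\<lambda>s. (s *\<^sub>R h) \<bullet> f (y + t *\<^sub>R h))) (at t)"
    using has_derivative_compose[of "\<lambda>t. y + t *\<^sub>R h"] by blast
  moreover have "(\<lambda>s. (s *\<^sub>R h) \<bullet> f (y + t *\<^sub>R h)) = (*) (f (y + t *\<^sub>R h) \<bullet> h)"
    by (auto simp: inner_commute)
  ultimately show ?thesis
    by (simp add: has_field_derivative_def)
qed

lemma smooth_upper_bound:
  assumes "smooth_with_gradient \<beta> L f"
  shows "L (y + h) \<le> L y + f y \<bullet> h + \<beta> / 2 * (norm h)\<^sup>2"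
proof -
  have grad: "\<And>y. GDERIV L y :> f y" and lip: "\<And>x y. norm (f x - f y) \<le> \<beta> * norm (x - y)"
    using assms by (auto simp: smooth_with_gradient_def lipschitz_on_def dist_norm)
  define \<phi> where "\<phi> = (\<lambda>t. L (y + t *\<^sub>R h) - t * (f y \<bullet> h) - \<beta> / 2 * t\<^sup>2 * (norm h)\<^sup>2)"
  have "\<phi> 1 \<le> \<phi> 0"
  proof (rule DERIV_nonpos_imp_nonincreasing[of 0 1 \<phi>])
    fix t :: real assume "0 \<le> t" "t \<le> 1"
    have "(f (y + t *\<^sub>R h) - f y) \<bullet> h \<le> norm (f (y + t *\<^sub>R h) - f y) * norm h"
      by (rule norm_cauchy_schwarz)
    also have "\<dots> \<le> (\<beta> * norm (t *\<^sub>R h)) * norm h"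
      using lip[of "y + t *\<^sub>R h" y] by (intro mult_right_mono) auto
    also have "\<dots> = \<beta> * t * (norm h)\<^sup>2"
      using \<open>0 \<le> t\<close> by (simp add: power2_eq_square)
    finally have "f (y + t *\<^sub>R h) \<bullet> h - f y \<bullet> h - \<beta> * t * (norm h)\<^sup>2 \<le> 0"
      by (simp add: inner_diff_left)
    moreover have "(\<phi> has_real_derivative f (y + t *\<^sub>R h) \<bullet> h - f y \<bullet> h - \<beta> * t * (norm h)\<^sup>2) (at t)"
      unfolding \<phi>_def by (auto intro!: derivative_eq_intros GDERIV_along_line[OF grad])
    ultimately show "\<exists>D. (\<phi> has_real_derivative D) (at t) \<and> D \<le> 0"
      by blast
  qed simp
  then show ?thesis
    by (simp add: \<phi>_def)
qed

text \<open>A gradient step of length \<open>1 / \<beta>\<close> decreases \<open>L\<close> by \<open>(norm (f y))\<^sup>2 / (2 * \<beta>)\<close>, and cannot go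
  below the minimum.\<close>

lemma gradient_norm_le_suboptimality:
  assumes "\<beta> > 0" "smooth_with_gradient \<beta> L f" and minimizer: "\<And>y. L ystar \<le> L y"
  shows "(norm (f y))\<^sup>2 \<le> 2 * \<beta> * (L y - L ystar)"
proof -
  have "L ystar \<le> L (y + (- (1 / \<beta>)) *\<^sub>R f y)"
    by (rule minimizer)
  also have "\<dots> \<le> L y + f y \<bullet> ((- (1 / \<beta>)) *\<^sub>R f y) + \<beta> / 2 * (norm ((- (1 / \<beta>)) *\<^sub>R f y))\<^sup>2"
    by (rule smooth_upper_bound[OF assms(2)])
  also have "\<dots> = L y - (norm (f y))\<^sup>2 / (2 * \<beta>)"
    using \<open>\<beta> > 0\<close> by (simp add: power2_norm_eq_inner[symmetric] power_mult_distrib power_divide field_simps power2_eq_square)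
  finally show ?thesis
    using \<open>\<beta> > 0\<close> by (simp add: field_simps)
qed

lemma strongly_convex_0_iff: "strongly_convex 0 L \<longleftrightarrow> convex_on UNIV L"
proof
  assume "strongly_convex 0 L"
  then show "convex_on UNIV L"
    by (intro convex_onI) (auto simp: strongly_convex_def)
next
  assume "convex_on UNIV L"
  then show "strongly_convex 0 L"
    by (auto simp: strongly_convex_def intro!: convex_onD)
qed

text \<open>The difference quotients of \<open>L\<close> along the segment from \<open>y\<close> to \<open>y + h\<close> obey the bound up to a factor
  \<open>1 - t\<close> at the quadratic term; let \<open>t\<close> tend to \<open>0\<close>.\<close>

lemma strongly_convex_gradient_lower_bound:
  assumes sc: "strongly_convex \<mu> L" and grad: "\<And>y. GDERIV L y :> f y"
  shows "L y + f y \<bullet> h + \<mu> / 2 * (norm h)\<^sup>2 \<le> L (y + h)"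
proof -
  have "((\<lambda>t. (L (y + t *\<^sub>R h) - L y) / t) \<longlongrightarrow> f y \<bullet> h) (at_right 0)"
    using GDERIV_along_line[OF grad, of y h 0]
    by (auto simp: has_field_derivative_iff intro: tendsto_within_subset)
  moreover have "((\<lambda>t. L (y + h) - L y - \<mu> / 2 * (1 - t) * (norm h)\<^sup>2) \<longlongrightarrow>
      L (y + h) - L y - \<mu> / 2 * (1 - 0) * (norm h)\<^sup>2) (at_right 0)"
    by (intro tendsto_intros)
  moreover have "\<forall>\<^sub>F t in at_right 0. (L (y + t *\<^sub>R h) - L y) / t \<le> L (y + h) - L y - \<mu> / 2 * (1 - t) * (norm h)\<^sup>2"
    unfolding eventually_at_right_field
  proof (intro exI[of _ 1] conjI allI impI)
    fix t :: real assume t: "0 < t" "t < 1"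
    have "L ((1 - t) *\<^sub>R y + t *\<^sub>R (y + h)) \<le>
        (1 - t) * L y + t * L (y + h) - \<mu> / 2 * t * (1 - t) * (norm (y - (y + h)))\<^sup>2"
      using sc[unfolded strongly_convex_def, rule_format, of t y "y + h"] t by simp
    moreover have "(1 - t) *\<^sub>R y + t *\<^sub>R (y + h) = y + t *\<^sub>R h"
      by (simp add: algebra_simps)
    ultimately have "L (y + t *\<^sub>R h) - L y \<le> t * (L (y + h) - L y - \<mu> / 2 * (1 - t) * (norm h)\<^sup>2)"
      by (simp add: algebra_simps)
    then show "(L (y + t *\<^sub>R h) - L y) / t \<le> L (y + h) - L y - \<mu> / 2 * (1 - t) * (norm h)\<^sup>2"
      using t by (simp add: divide_le_eq mult.commute)
  qed simp
  ultimately have "f y \<bullet> h \<le> L (y + h) - L y - \<mu> / 2 * (1 - 0) * (norm h)\<^sup>2"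
    by (intro tendsto_le[OF _ _ _ ]) auto
  then show ?thesis by simp
qed

section \<open>One step of the iteration\<close>

text \<open>Here \<open>m\<close> and \<open>V\<close> stand for the mean and the variance of the direction. Half of the progress
  \<open>2 * \<eta> * (L y - L ystar)\<close> is spent on \<open>\<eta>\<^sup>2 * (norm m)\<^sup>2\<close>, whose gradient part is at most
  \<open>4 * \<beta> * \<eta>\<^sup>2 * (L y - L ystar)\<close>.\<close>

lemma biased_gradient_step:
  fixes f :: "'a::euclidean_space \<Rightarrow> 'a"
  assumes smooth: "\<beta> > 0" "smooth_with_gradient \<beta> L f"
    and sc: "strongly_convex \<mu> L"
    and minimizer: "\<And>y. L ystar \<le> L y"
    and \<eta>: "0 < \<eta>" "\<eta> \<le> 1 / (4 * \<beta>)"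
    and bias: "norm (m - f y) \<le> \<delta>" and "V \<le> \<sigma>\<^sup>2"
  shows "(norm (y - ystar))\<^sup>2 - 2 * \<eta> * (m \<bullet> (y - ystar)) + \<eta>\<^sup>2 * ((norm m)\<^sup>2 + V) \<le>
    (1 - \<eta> * \<mu>) * (norm (y - ystar))\<^sup>2 - \<eta> * (L y - L ystar) + 2 * \<eta> * \<delta> * norm (y - ystar)
      + \<eta>\<^sup>2 * (2 * \<delta>\<^sup>2 + \<sigma>\<^sup>2)"
proof -
  define u where "u = y - ystar"
  define e where "e = L y - L ystar"
  define g where "g = f y"
  have "e \<ge> 0"
    using minimizer by (simp add: e_def)
  have "L y + f y \<bullet> (- u) + \<mu> / 2 * (norm (- u))\<^sup>2 \<le> L (y + (- u))"
    using smooth by (intro strongly_convex_gradient_lower_bound[OF sc]) (auto simp: smooth_with_gradient_def)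
  moreover have "y + (- u) = ystar"
    by (simp add: u_def)
  ultimately have gu: "g \<bullet> u \<ge> e + \<mu> / 2 * (norm u)\<^sup>2"
    by (simp only: e_def g_def inner_minus_right norm_minus_cancel)
  have "(g - m) \<bullet> u \<le> norm (g - m) * norm u"
    by (rule norm_cauchy_schwarz)
  also have "\<dots> \<le> \<delta> * norm u"
    using bias by (intro mult_right_mono) (auto simp: g_def norm_minus_commute)
  finally have mu: "m \<bullet> u \<ge> e + \<mu> / 2 * (norm u)\<^sup>2 - \<delta> * norm u"
    using gu by (simp add: inner_diff_left)
  have "(norm m)\<^sup>2 \<le> (norm g + \<delta>)\<^sup>2"
    using bias norm_triangle_sub[of m g] by (intro power_mono) (auto simp: g_def)
  also have "\<dots> \<le> 2 * (norm g)\<^sup>2 + 2 * \<delta>\<^sup>2"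
    using zero_le_power2[of "norm g - \<delta>"] by (simp add: power2_eq_square algebra_simps)
  also have "(norm g)\<^sup>2 \<le> 2 * \<beta> * e"
    unfolding g_def e_def by (rule gradient_norm_le_suboptimality[OF smooth minimizer])
  finally have "\<eta>\<^sup>2 * ((norm m)\<^sup>2 + V) \<le> \<eta>\<^sup>2 * (4 * \<beta> * e + 2 * \<delta>\<^sup>2 + \<sigma>\<^sup>2)"
    using \<open>V \<le> \<sigma>\<^sup>2\<close> by (intro mult_left_mono) auto
  also have "\<dots> = (4 * \<beta> * \<eta>) * (\<eta> * e) + \<eta>\<^sup>2 * (2 * \<delta>\<^sup>2 + \<sigma>\<^sup>2)"
    by (simp add: power2_eq_square algebra_simps)
  also have "(4 * \<beta> * \<eta>) * (\<eta> * e) \<le> 1 * (\<eta> * e)"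
    using \<eta> smooth(1) \<open>e \<ge> 0\<close> by (intro mult_right_mono) (auto simp: field_simps)
  finally have sq: "\<eta>\<^sup>2 * ((norm m)\<^sup>2 + V) \<le> \<eta> * e + \<eta>\<^sup>2 * (2 * \<delta>\<^sup>2 + \<sigma>\<^sup>2)"
    by simp
  have "2 * \<eta> * (e + \<mu> / 2 * (norm u)\<^sup>2 - \<delta> * norm u) \<le> 2 * \<eta> * (m \<bullet> u)"
    using mu \<eta> by (intro mult_left_mono) auto
  then show ?thesis
    using sq by (simp add: u_def[symmetric] e_def[symmetric] algebra_simps)
qed

section \<open>The stochastic iteration\<close>

lemma iterate_cong:
  assumes "\<And>s. s < t \<Longrightarrow> w s = w' s"
  shows "iterate \<gamma> c \<delta> \<sigma> A \<eta> y0 w t = iterate \<gamma> c \<delta> \<sigma> A \<eta> y0 w' t"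
  using assms by (induction t) auto

lemma finite_run_draws: "finite (set_pmf (run_draws TYPE('a::euclidean_space) \<gamma> c \<delta> \<sigma> T))"
  unfolding run_draws_def by (intro finite_set_Pi_pmf finite_call_draw) auto

text \<open>The iterate \<open>y w t\<close> depends on the draws before \<open>t\<close> only, so conditionally on them the draw of step
  \<open>t\<close> is a fresh oracle call at a fixed point.\<close>

lemma expected_distance_step:
  fixes L :: "'a::euclidean_space \<Rightarrow> real" and f :: "'a \<Rightarrow> 'a" and y0 :: 'a
    and A :: "int \<Rightarrow> 'a \<Rightarrow> 'a" and \<gamma> c \<delta> \<sigma> \<eta> :: real and T :: nat
  defines "P \<equiv> run_draws TYPE('a) \<gamma> c \<delta> \<sigma> T" and "y \<equiv> iterate \<gamma> c \<delta> \<sigma> A \<eta> y0"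
  assumes smooth: "\<beta> > 0" "smooth_with_gradient \<beta> L f"
    and sc: "strongly_convex \<mu> L"
    and minimizer: "\<And>y. L ystar \<le> L y"
    and hierarchy: "\<gamma> > 0" "\<delta> > 0" "dyadic_hierarchy \<gamma> c f A cost"
    and \<eta>: "0 < \<eta>" "\<eta> \<le> 1 / (4 * \<beta>)"
    and base: "\<forall>w\<in>set_pmf P. \<forall>t<T. zero_accurate c f (y w t)"
    and "t < T"
  shows "measure_pmf.expectation P (\<lambda>w. (norm (y w (Suc t) - ystar))\<^sup>2) \<le>
    measure_pmf.expectation P (\<lambda>w. (1 - \<eta> * \<mu>) * (norm (y w t - ystar))\<^sup>2
      - \<eta> * (L (y w t) - L ystar) + 2 * \<eta> * \<delta> * norm (y w t - ystar) + \<eta>\<^sup>2 * (2 * \<delta>\<^sup>2 + \<sigma>\<^sup>2))"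
proof -
  define C where "C = ml_const TYPE('a) \<gamma> c \<delta> \<sigma>"
  have "C > 0" and vg: "variance_guaranteed TYPE('a) \<gamma> c \<delta> \<sigma> C"
    using ml_const_optimal[OF hierarchy(1), of c \<delta> \<sigma>, where 'a = 'a]
    unfolding optimal_constant_def C_def by blast+
  define D where "D = call_draw \<gamma> c \<delta> C"
  define Q where "Q = Pi_pmf ({..<T} - {t}) (\<lambda>_. False) (\<lambda>_. D)"
  define \<Phi> where "\<Phi> = (\<lambda>z. (1 - \<eta> * \<mu>) * (norm (z - ystar))\<^sup>2
      - \<eta> * (L z - L ystar) + 2 * \<eta> * \<delta> * norm (z - ystar) + \<eta>\<^sup>2 * (2 * \<delta>\<^sup>2 + \<sigma>\<^sup>2))"
  have finD: "finite (set_pmf D)"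
    unfolding D_def by (rule finite_call_draw)
  have finQ: "finite (set_pmf Q)"
    unfolding Q_def by (intro finite_set_Pi_pmf finD) auto
  have P_eq: "P = Pi_pmf {..<T} (\<lambda>_. False) (\<lambda>_. D)"
    by (simp add: P_def run_draws_def D_def C_def)
  have split: "measure_pmf.expectation P F =
      measure_pmf.expectation Q (\<lambda>w. measure_pmf.expectation D (\<lambda>b. F (w(t := b))))"
    for F :: "_ \<Rightarrow> real"
    unfolding P_eq Q_def using \<open>t < T\<close> by (intro expectation_Pi_pmf_resample finD) auto
  have indep: "y (w(t := b)) t = y w t" for w b
    unfolding y_def by (rule iterate_cong) auto
  have step: "y (w(t := b)) (Suc t) = y w t - \<eta> *\<^sub>R ml_gradient \<gamma> c \<delta> C A b (y w t)" for w b
    using indep[of w b] by (simp add: y_def C_def)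
  have one_call: "measure_pmf.expectation D (\<lambda>b. (norm (y (w(t := b)) (Suc t) - ystar))\<^sup>2) \<le> \<Phi> (y w t)"
    if w: "w \<in> set_pmf Q" for w
  proof -
    obtain b where "b \<in> set_pmf D"
      using set_pmf_not_empty by fast
    then have "w(t := b) \<in> set_pmf P"
      using w \<open>t < T\<close> unfolding P_eq Q_def
      by (auto simp: set_Pi_pmf PiE_dflt_def)
    then have za: "zero_accurate c f (y w t)"
      using base \<open>t < T\<close> indep[of w b] by metis
    define m where "m = measure_pmf.expectation D (\<lambda>b. ml_gradient \<gamma> c \<delta> C A b (y w t))"
    have "measure_pmf.expectation D (\<lambda>b. (norm (y (w(t := b)) (Suc t) - ystar))\<^sup>2) =
        measure_pmf.expectation D (\<lambda>b. (norm ((y w t - ystar) - \<eta> *\<^sub>R ml_gradient \<gamma> c \<delta> C A b (y w t)))\<^sup>2)"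
      unfolding step by (simp add: diff_diff_eq add.commute)
    also have "\<dots> = (norm (y w t - ystar))\<^sup>2 - 2 * \<eta> * (m \<bullet> (y w t - ystar))
        + \<eta>\<^sup>2 * ((norm m)\<^sup>2 + oracle_variance \<gamma> c \<delta> C A (y w t))"
      unfolding m_def oracle_variance_def D_def
      by (rule second_moment_about_shift[OF finite_call_draw])
    also have "\<dots> \<le> \<Phi> (y w t)"
      unfolding \<Phi>_def
    proof (rule biased_gradient_step[OF smooth sc minimizer \<eta>])
      show "norm (m - f (y w t)) \<le> \<delta>"
        unfolding m_def D_def by (rule ml_gradient_bias[OF \<open>C > 0\<close> hierarchy(2,3) za])
      show "oracle_variance \<gamma> c \<delta> C A (y w t) \<le> \<sigma>\<^sup>2"
        by (rule variance_guaranteed_imp[OF vg hierarchy(3) za])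
    qed
    finally show ?thesis .
  qed
  have "measure_pmf.expectation P (\<lambda>w. (norm (y w (Suc t) - ystar))\<^sup>2) \<le>
      measure_pmf.expectation Q (\<lambda>w. \<Phi> (y w t))"
    unfolding split using one_call
    by (intro integral_mono_AE integrable_measure_pmf_finite finQ) (simp add: AE_measure_pmf_iff)
  also have "\<dots> = measure_pmf.expectation P (\<lambda>w. \<Phi> (y w t))"
    unfolding split indep by simp
  finally show ?thesis
    by (simp add: \<Phi>_def)
qed

section \<open>Accuracy of the averaged iterates\<close>

lemma convex_weighted_average:
  fixes L :: "'a::real_vector \<Rightarrow> real" and T :: nat
  assumes "convex_on UNIV L" and w: "\<And>t. t < T \<Longrightarrow> w t > 0" and "T > 0"
  shows "L ((1 / sum w {..<T}) *\<^sub>R (\<Sum>t<T. w t *\<^sub>R y t)) - l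
    \<le> (1 / sum w {..<T}) * (\<Sum>t<T. w t * (L (y t) - l))"
proof -
  define W where "W = sum w {..<T}"
  have "W > 0"
    unfolding W_def using w \<open>T > 0\<close> by (intro sum_pos) auto
  have one: "(\<Sum>t<T. w t / W) = 1"
    using \<open>W > 0\<close> by (simp add: W_def flip: sum_divide_distrib)
  have "L ((1 / W) *\<^sub>R (\<Sum>t<T. w t *\<^sub>R y t)) = L (\<Sum>t<T. (w t / W) *\<^sub>R y t)"
    by (simp add: scaleR_sum_right)
  also have "\<dots> \<le> (\<Sum>t<T. w t / W * L (y t))"
    using assms one \<open>W > 0\<close> by (intro convex_on_sum[of _ UNIV]) (auto intro: less_imp_le)
  also have "\<dots> = (\<Sum>t<T. w t / W * (L (y t) - l)) + (\<Sum>t<T. w t / W) * l"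
    unfolding sum_distrib_right sum.distrib[symmetric] by (simp add: algebra_simps)
  finally show ?thesis
    using one by (simp add: W_def sum_distrib_left)
qed

text \<open>Here \<open>a t\<close> and \<open>e t\<close> are the mean squared distance and the mean suboptimality. The bias
  multiplies the distance, so the distance has to be bounded along the run: as long as
  \<open>a t \<le> 4 * d0\<^sup>2\<close>, a step adds at most \<open>17 / 32 * \<eta> * \<epsilon>\<close>, and before the last step these
  additions total at most \<open>17 / 8 * d0\<^sup>2\<close>, which preserves the bound.\<close>

lemma convex_recurrence:
  fixes a e :: "nat \<Rightarrow> real" and T :: nat
  assumes pos: "d0 > 0" "\<epsilon> > 0" "\<eta> > 0" and "\<eta> * \<epsilon> \<le> 4 * d0\<^sup>2"
    and a: "a 0 = d0\<^sup>2" "\<And>t. a t \<ge> 0" and e: "\<And>t. e t \<ge> 0"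
    and T: "T = nat \<lceil>4 * d0\<^sup>2 / (\<eta> * \<epsilon>)\<rceil>"
    and step: "\<And>t. t < T \<Longrightarrow> a (Suc t) \<le> a t - \<eta> * e t + \<eta> * (\<epsilon> / (16 * d0)) * (a t / (2 * d0) + 2 * d0)
      + \<eta>\<^sup>2 * (2 * (\<epsilon> / (16 * d0))\<^sup>2 + \<epsilon> / (4 * \<eta>))"
  shows "(\<Sum>t<T. e t) \<le> real T * \<epsilon>"
proof -
  define B where "B = 17 / 32 * (\<eta> * \<epsilon>)"
  have noise: "\<eta>\<^sup>2 * (2 * (\<epsilon> / (16 * d0))\<^sup>2 + \<epsilon> / (4 * \<eta>)) \<le> 9 / 32 * (\<eta> * \<epsilon>)"
  proof -
    have "\<eta>\<^sup>2 * (2 * (\<epsilon> / (16 * d0))\<^sup>2 + \<epsilon> / (4 * \<eta>)) = (\<eta> * \<epsilon>) * (\<eta> * \<epsilon> / d0\<^sup>2) / 128 + \<eta> * \<epsilon> / 4"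
      using pos by (simp add: field_simps power2_eq_square)
    also have "\<dots> \<le> (\<eta> * \<epsilon>) * 4 / 128 + \<eta> * \<epsilon> / 4"
      using assms(4) pos by (intro add_right_mono divide_right_mono mult_left_mono) (auto simp: divide_le_eq)
    finally show ?thesis by linarith
  qed
  have steps: "real t * (\<eta> * \<epsilon>) \<le> 4 * d0\<^sup>2" if "t < T" for t
  proof -
    have "real t < 4 * d0\<^sup>2 / (\<eta> * \<epsilon>)"
      using that unfolding T by linarith
    then show ?thesis
      using pos by (simp add: less_divide_eq)
  qed
  have bound: "a t + \<eta> * (\<Sum>s<t. e s) \<le> d0\<^sup>2 + real t * B" if "t \<le> T" for t
    using that
  proof (induction t)
    case (Suc t)
    then have IH: "a t + \<eta> * (\<Sum>s<t. e s) \<le> d0\<^sup>2 + real t * B" and "t < T"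
      by auto
    have "0 \<le> \<eta> * (\<Sum>s<t. e s)"
      using e pos by (intro mult_nonneg_nonneg sum_nonneg) auto
    moreover have "real t * B \<le> 17 / 8 * d0\<^sup>2"
      using steps[OF \<open>t < T\<close>] by (simp add: B_def mult_ac)
    ultimately have "a t \<le> 4 * d0\<^sup>2"
      using IH zero_le_power2[of d0] by linarith
    then have "a t / (2 * d0) + 2 * d0 \<le> 4 * d0"
      using pos by (simp add: field_simps power2_eq_square)
    then have "\<eta> * (\<epsilon> / (16 * d0)) * (a t / (2 * d0) + 2 * d0) \<le> \<eta> * (\<epsilon> / (16 * d0)) * (4 * d0)"
      using pos by (intro mult_left_mono) auto
    also have "\<dots> = \<eta> * \<epsilon> / 4"
      using pos by simp
    finally have "a (Suc t) \<le> a t - \<eta> * e t + B"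
      using step[OF \<open>t < T\<close>] noise unfolding B_def by argo
    then show ?case
      using IH by (simp add: algebra_simps)
  qed (use a in auto)
  have "4 * d0\<^sup>2 / (\<eta> * \<epsilon>) \<le> real T"
    unfolding T by linarith
  then have "4 * d0\<^sup>2 \<le> real T * (\<eta> * \<epsilon>)"
    using pos by (simp add: divide_le_eq)
  moreover have "real T * B = 17 / 32 * (real T * (\<eta> * \<epsilon>))"
    by (simp add: B_def)
  ultimately have "\<eta> * (\<Sum>s<T. e s) \<le> real T * (\<eta> * \<epsilon>)"
    using bound[of T] a(2)[of T] zero_le_power2[of d0] by linarith
  then have "\<eta> * (\<Sum>s<T. e s) \<le> \<eta> * (real T * \<epsilon>)"
    by (simp add: mult_ac)
  then show ?thesis
    using pos by simp
qed

text \<open>A very large \<open>\<epsilon>\<close> with \<open>\<eta> * \<epsilon> > 4 * d0\<^sup>2\<close> is separate: then \<open>T = 1\<close>, the average is the starting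
  point, and smoothness alone gives the bound.\<close>

lemma ml_sgd_convex_accuracy:
  fixes L :: "'a::euclidean_space \<Rightarrow> real" and f :: "'a \<Rightarrow> 'a" and y0 ystar :: 'a
    and A :: "int \<Rightarrow> 'a \<Rightarrow> 'a" and \<gamma> c \<epsilon> \<eta> d0 :: real
  defines "T \<equiv> T_convex d0 \<eta> \<epsilon>" and "\<delta> \<equiv> \<delta>_convex d0 \<epsilon>" and "\<sigma> \<equiv> \<sigma>_convex \<eta> \<epsilon>"
  defines "P \<equiv> run_draws TYPE('a) \<gamma> c \<delta> \<sigma> T" and "y \<equiv> iterate \<gamma> c \<delta> \<sigma> A \<eta> y0"
  assumes convex: "convex_on UNIV L"
    and smooth: "\<beta> > 0" "smooth_with_gradient \<beta> L f"
    and minimizer: "\<And>y. L ystar \<le> L y"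
    and d0: "d0 = norm (y0 - ystar)" "d0 > 0"
    and hierarchy: "\<gamma> > 0" "dyadic_hierarchy \<gamma> c f A cost"
    and "\<epsilon> > 0" and \<eta>: "0 < \<eta>" "\<eta> \<le> 1 / (4 * \<beta>)"
    and base: "\<forall>w\<in>set_pmf P. \<forall>t<T. zero_accurate c f (y w t)"
  shows "measure_pmf.expectation P (\<lambda>w. L (average T (y w)) - L ystar) \<le> \<epsilon>"
proof -
  have fin: "finite (set_pmf P)"
    unfolding P_def by (rule finite_run_draws)
  note [simp] = integrable_measure_pmf_finite[OF fin]
  define x where "x = 4 * d0\<^sup>2 / (\<eta> * \<epsilon>)"
  have "x > 0"
    using d0 \<eta> \<open>\<epsilon> > 0\<close> by (simp add: x_def)
  have T: "T = nat \<lceil>x\<rceil>"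
    by (simp add: T_def T_convex_def x_def)
  then have "T > 0"
    using \<open>x > 0\<close> by simp
  show ?thesis
  proof (cases "\<eta> * \<epsilon> \<le> 4 * d0\<^sup>2")
    case False
    then have "x \<le> 1"
      using \<open>\<epsilon> > 0\<close> \<eta> by (simp add: x_def)
    then have "\<lceil>x\<rceil> = 1"
      using \<open>x > 0\<close> by (simp add: ceiling_eq_iff)
    then have "average T (y w) = y0" for w
      by (simp add: T average_def y_def)
    then have "measure_pmf.expectation P (\<lambda>w. L (average T (y w)) - L ystar) = L y0 - L ystar"
      by simp
    also have "L y0 \<le> L ystar + f ystar \<bullet> (y0 - ystar) + \<beta> / 2 * (norm (y0 - ystar))\<^sup>2"
      using smooth_upper_bound[OF smooth(2), of ystar "y0 - ystar"] by simp
    also have "f ystar = 0"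
      using gradient_norm_le_suboptimality[OF smooth minimizer, of ystar] by simp
    also have "L ystar + 0 \<bullet> (y0 - ystar) + \<beta> / 2 * (norm (y0 - ystar))\<^sup>2 - L ystar = \<beta> * d0\<^sup>2 / 2"
      by (simp add: d0(1))
    also have "\<dots> \<le> \<beta> * (\<eta> * \<epsilon> / 4) / 2"
      using False smooth(1) by (intro divide_right_mono mult_left_mono) auto
    also have "\<dots> = (4 * \<beta> * \<eta>) * \<epsilon> / 32"
      by simp
    also have "\<dots> \<le> 1 * \<epsilon> / 32"
      using \<eta> smooth(1) \<open>\<epsilon> > 0\<close> by (intro divide_right_mono mult_right_mono) (auto simp: field_simps)
    finally show ?thesis
      using \<open>\<epsilon> > 0\<close> by simp
  next
    case True
    define a where "a = (\<lambda>t. measure_pmf.expectation P (\<lambda>w. (norm (y w t - ystar))\<^sup>2))"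
    define e where "e = (\<lambda>t. measure_pmf.expectation P (\<lambda>w. L (y w t) - L ystar))"
    have \<delta>: "\<delta> = \<epsilon> / (16 * d0)" and \<sigma>: "\<sigma>\<^sup>2 = \<epsilon> / (4 * \<eta>)" and "\<delta> > 0"
      using d0 \<eta> \<open>\<epsilon> > 0\<close> by (simp_all add: \<delta>_def \<delta>_convex_def \<sigma>_def \<sigma>_convex_def)
    have "(\<Sum>t<T. e t) \<le> real T * \<epsilon>"
    proof (rule convex_recurrence[OF d0(2) \<open>\<epsilon> > 0\<close> \<eta>(1) True])
      show "a 0 = d0\<^sup>2"
        by (simp add: a_def y_def d0(1))
      show "a t \<ge> 0" for t
        by (simp add: a_def)
      show "e t \<ge> 0" for t
        unfolding e_def by (rule Bochner_Integration.integral_nonneg) (simp add: minimizer)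
      show "T = nat \<lceil>4 * d0\<^sup>2 / (\<eta> * \<epsilon>)\<rceil>"
        by (simp add: T x_def)
      fix t assume "t < T"
      have "a (Suc t) \<le> measure_pmf.expectation P (\<lambda>w. (1 - \<eta> * 0) * (norm (y w t - ystar))\<^sup>2
        - \<eta> * (L (y w t) - L ystar) + 2 * \<eta> * \<delta> * norm (y w t - ystar) + \<eta>\<^sup>2 * (2 * \<delta>\<^sup>2 + \<sigma>\<^sup>2))"
        unfolding a_def P_def y_def
        by (rule expected_distance_step[OF smooth _ minimizer hierarchy(1) \<open>\<delta> > 0\<close> hierarchy(2) \<eta> _ \<open>t < T\<close>])
           (use convex base in \<open>simp_all add: strongly_convex_0_iff P_def y_def\<close>)
      also have "\<dots> \<le> measure_pmf.expectation P (\<lambda>w. (norm (y w t - ystar))\<^sup>2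
        - \<eta> * (L (y w t) - L ystar) + \<eta> * \<delta> * ((norm (y w t - ystar))\<^sup>2 / (2 * d0) + 2 * d0)
        + \<eta>\<^sup>2 * (2 * \<delta>\<^sup>2 + \<sigma>\<^sup>2))"
      proof (intro integral_mono)
        fix w
        \<comment> \<open>Balanced at \<open>r = 2 * d0\<close>, the bound on the root mean squared distance along the run.\<close>
        have "2 * r \<le> r\<^sup>2 / (2 * d0) + 2 * d0" for r
          using zero_le_power2[of "r - 2 * d0"] d0(2)
          by (simp add: field_simps power2_eq_square)
        from mult_left_mono[OF this, of "\<eta> * \<delta>" "norm (y w t - ystar)"]
        show "(1 - \<eta> * 0) * (norm (y w t - ystar))\<^sup>2 - \<eta> * (L (y w t) - L ystar)
            + 2 * \<eta> * \<delta> * norm (y w t - ystar) + \<eta>\<^sup>2 * (2 * \<delta>\<^sup>2 + \<sigma>\<^sup>2)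
          \<le> (norm (y w t - ystar))\<^sup>2 - \<eta> * (L (y w t) - L ystar)
            + \<eta> * \<delta> * ((norm (y w t - ystar))\<^sup>2 / (2 * d0) + 2 * d0) + \<eta>\<^sup>2 * (2 * \<delta>\<^sup>2 + \<sigma>\<^sup>2)"
          using \<eta> \<open>\<delta> > 0\<close> by simp
      qed simp_all
      also have "\<dots> = a t - \<eta> * e t + \<eta> * \<delta> * (a t / (2 * d0) + 2 * d0) + \<eta>\<^sup>2 * (2 * \<delta>\<^sup>2 + \<sigma>\<^sup>2)"
        by (simp add: a_def e_def)
      finally show "a (Suc t) \<le> a t - \<eta> * e t + \<eta> * (\<epsilon> / (16 * d0)) * (a t / (2 * d0) + 2 * d0)
          + \<eta>\<^sup>2 * (2 * (\<epsilon> / (16 * d0))\<^sup>2 + \<epsilon> / (4 * \<eta>))"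
        unfolding \<delta> \<sigma> .
    qed
    have "L (average T (y w)) - L ystar \<le> (1 / real T) * (\<Sum>t<T. L (y w t) - L ystar)" for w
      using convex_weighted_average[OF convex, of T "\<lambda>_. 1" "y w" "L ystar"] \<open>T > 0\<close>
      by (simp add: average_def)
    then have "measure_pmf.expectation P (\<lambda>w. L (average T (y w)) - L ystar) \<le>
        measure_pmf.expectation P (\<lambda>w. (1 / real T) * (\<Sum>t<T. L (y w t) - L ystar))"
      by (intro integral_mono) simp_all
    also have "\<dots> = (1 / real T) * (\<Sum>t<T. e t)"
      unfolding e_def by (subst Bochner_Integration.integral_sum[symmetric]) simp_all
    also have "\<dots> \<le> \<epsilon>"
      using \<open>(\<Sum>t<T. e t) \<le> real T * \<epsilon>\<close> \<open>T > 0\<close> by (simp add: field_simps)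
    finally show ?thesis .
  qed
qed

text \<open>Multiplying the step at \<open>t\<close> by \<open>(1 - \<eta> * \<mu>) powr (- (t + 1))\<close> makes the distances telescope. The
  initial distance is divided by the sum of the weights, which is of order
  \<open>exp (\<eta> * \<mu> * T) / (\<eta> * \<mu>)\<close> and so exceeds \<open>a 0 / (\<eta> * \<epsilon>)\<close> by the choice of \<open>T\<close>.\<close>

lemma strong_recurrence:
  fixes a e :: "nat \<Rightarrow> real" and T :: nat
  assumes pos: "\<mu> > 0" "\<epsilon> > 0" "\<eta> > 0" and "\<eta> * \<mu> \<le> 1 / 4"
    and "\<epsilon> \<le> \<mu> * a 0" and a: "\<And>t. a t \<ge> 0"
    and T: "4 / (\<eta> * \<mu>) * ln (256 * \<mu> * a 0 / \<epsilon>) \<le> real T"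
    and step: "\<And>t. t < T \<Longrightarrow> a (Suc t) \<le> (1 - \<eta> * \<mu>) * a t - \<eta> / 2 * e t + \<eta> * (\<epsilon> / 5)"
  shows "(\<Sum>t<T. (1 - \<eta> * \<mu>) powr (- real t) * e t) \<le> (\<Sum>t<T. (1 - \<eta> * \<mu>) powr (- real t)) * \<epsilon>"
proof -
  define q where "q = 1 - \<eta> * \<mu>"
  have q: "q > 0" "q < 1"
    using pos assms(4) by (simp_all add: q_def)
  define r where "r = 1 / q"
  have "r > 1"
    using q by (simp add: r_def)
  have w: "(1 - \<eta> * \<mu>) powr (- real t) = r ^ t" for t
    using q by (simp add: r_def q_def[symmetric] powr_minus_divide powr_realpow power_divide)
  have bound: "r ^ t * a t + \<eta> / 2 * r * (\<Sum>s<t. r ^ s * e s) \<le> a 0 + \<eta> * r * (\<epsilon> / 5) * (\<Sum>s<t. r ^ s)"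
    if "t \<le> T" for t
    using that
  proof (induction t)
    case (Suc t)
    have "r ^ Suc t * a (Suc t) \<le> r ^ Suc t * (q * a t - \<eta> / 2 * e t + \<eta> * (\<epsilon> / 5))"
      using step[of t] Suc.prems \<open>r > 1\<close> by (intro mult_left_mono) (auto simp: q_def)
    also have "\<dots> = r ^ t * (r * q) * a t - \<eta> / 2 * r * (r ^ t * e t) + \<eta> * r * (\<epsilon> / 5) * r ^ t"
      by (simp add: algebra_simps)
    also have "r * q = 1"
      using q by (simp add: r_def)
    finally show ?case
      using Suc by (simp add: algebra_simps add_divide_distrib)
  qed simp
  define W where "W = (\<Sum>t<T. r ^ t)"
  define Z where "Z = 256 * \<mu> * a 0 / \<epsilon>"
  have "Z \<ge> 256"
    using assms(5) pos by (simp add: Z_def field_simps)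
  have "exp (\<eta> * \<mu>) \<le> r"
  proof -
    have "q \<le> exp (- (\<eta> * \<mu>))"
      using exp_ge_add_one_self[of "- (\<eta> * \<mu>)"] by (simp add: q_def)
    then show ?thesis
      using q by (simp add: r_def exp_minus field_simps)
  qed
  have "ln Z \<le> 4 * ln Z"
    using \<open>Z \<ge> 256\<close> by simp
  also have "4 * ln Z \<le> \<eta> * \<mu> * real T"
    using T pos by (simp add: Z_def field_simps)
  finally have "Z \<le> exp (\<eta> * \<mu> * real T)"
    using \<open>Z \<ge> 256\<close> by (metis exp_le_cancel_iff exp_ln less_le_trans zero_less_numeral)
  also have "\<dots> = exp (\<eta> * \<mu>) ^ T"
    by (simp add: exp_of_nat_mult[symmetric] mult.commute)
  also have "\<dots> \<le> r ^ T"
    using \<open>exp (\<eta> * \<mu>) \<le> r\<close> by (intro power_mono) auto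
  finally have "Z \<le> r ^ T" .
  moreover have "W * (\<eta> * \<mu> * r) = r ^ T - 1"
  proof -
    have "r - 1 = \<eta> * \<mu> * r"
      using q by (simp add: r_def field_simps) (simp add: q_def)
    then show ?thesis
      using power_diff_1_eq[of r T] by (simp add: W_def mult.commute)
  qed
  ultimately have "Z * (255 / 256) \<le> W * (\<eta> * \<mu> * r)"
    using \<open>Z \<ge> 256\<close> by simp
  then have "\<mu> * (255 * a 0) \<le> \<mu> * (W * \<eta> * r * \<epsilon>)"
    using pos by (simp add: Z_def field_simps)
  then have "255 * a 0 \<le> W * \<eta> * r * \<epsilon>"
    using pos by simp
  moreover have "0 \<le> r ^ T * a T"
    using a[of T] \<open>r > 1\<close> by simp
  moreover have "0 \<le> W * \<eta> * r * \<epsilon>"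
    using pos \<open>r > 1\<close> by (auto simp: W_def intro!: mult_nonneg_nonneg sum_nonneg)
  ultimately have "\<eta> / 2 * r * (\<Sum>s<T. r ^ s * e s) \<le> \<eta> / 2 * r * (W * \<epsilon>)"
    using bound[of T] unfolding W_def[symmetric] by (simp add: mult_ac)
  then show ?thesis
    using pos \<open>r > 1\<close> by (simp add: w W_def)
qed

lemma ml_sgd_strongly_convex_accuracy:
  fixes L :: "'a::euclidean_space \<Rightarrow> real" and f :: "'a \<Rightarrow> 'a" and y0 ystar :: 'a
    and A :: "int \<Rightarrow> 'a \<Rightarrow> 'a" and \<gamma> c \<epsilon> \<eta> \<mu> d0 :: real
  defines "T \<equiv> T_strong \<mu> d0 \<eta> \<epsilon>" and "\<delta> \<equiv> \<delta>_strong \<mu> \<epsilon>" and "\<sigma> \<equiv> \<sigma>_strong \<eta> \<epsilon>"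
  defines "P \<equiv> run_draws TYPE('a) \<gamma> c \<delta> \<sigma> T" and "y \<equiv> iterate \<gamma> c \<delta> \<sigma> A \<eta> y0"
  assumes convex: "convex_on UNIV L"
    and smooth: "\<beta> > 0" "smooth_with_gradient \<beta> L f"
    and sc: "0 < \<mu>" "\<mu> \<le> \<beta>" "strongly_convex \<mu> L"
    and minimizer: "\<And>y. L ystar \<le> L y"
    and d0: "d0 = norm (y0 - ystar)"
    and hierarchy: "\<gamma> > 0" "dyadic_hierarchy \<gamma> c f A cost"
    and \<epsilon>: "\<epsilon> > 0" "\<epsilon> \<le> \<mu> * d0\<^sup>2" and \<eta>: "0 < \<eta>" "\<eta> \<le> 1 / (4 * \<beta>)"
    and base: "\<forall>w\<in>set_pmf P. \<forall>t<T. zero_accurate c f (y w t)"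
  shows "measure_pmf.expectation P (\<lambda>w. L (geometric_average (1 - \<eta> * \<mu>) T (y w)) - L ystar) \<le> \<epsilon>"
proof -
  have fin: "finite (set_pmf P)"
    unfolding P_def by (rule finite_run_draws)
  note [simp] = integrable_measure_pmf_finite[OF fin]
  define x where "x = 4 / (\<eta> * \<mu>) * ln (256 * \<mu> * d0\<^sup>2 / \<epsilon>)"
  have "256 * \<mu> * d0\<^sup>2 / \<epsilon> > 1"
    using \<epsilon> by (simp add: field_simps)
  then have "x > 0"
    unfolding x_def using sc(1) \<eta>(1) by (intro mult_pos_pos) auto
  have T: "T = nat \<lceil>x\<rceil>"
    unfolding T_def T_strong_def x_def ..
  have "T > 0" and "x \<le> real T"
    unfolding T using \<open>x > 0\<close> by (simp, linarith)
  have "\<eta> * \<mu> \<le> 1 / (4 * \<beta>) * \<beta>"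
    using \<eta> sc smooth(1) by (intro mult_mono) auto
  then have \<eta>\<mu>: "\<eta> * \<mu> \<le> 1 / 4"
    using smooth(1) by simp
  define a where "a = (\<lambda>t. measure_pmf.expectation P (\<lambda>w. (norm (y w t - ystar))\<^sup>2))"
  define e where "e = (\<lambda>t. measure_pmf.expectation P (\<lambda>w. L (y w t) - L ystar))"
  define v where "v = (\<lambda>t. (1 - \<eta> * \<mu>) powr (- real t))"
  have \<delta>: "\<delta>\<^sup>2 = \<mu> * \<epsilon> / 64" and \<sigma>: "\<sigma>\<^sup>2 = \<epsilon> / (8 * \<eta>)" and "\<delta> > 0"
    using sc(1) \<eta> \<epsilon>(1)
    by (simp_all add: \<delta>_def \<delta>_strong_def \<sigma>_def \<sigma>_strong_def power_divide)
  have a0: "a 0 = d0\<^sup>2"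
    by (simp add: a_def y_def d0)
  have noise: "\<eta>\<^sup>2 * (2 * \<delta>\<^sup>2 + \<sigma>\<^sup>2) \<le> \<eta> * (\<epsilon> / 5 - \<epsilon> / 16)"
  proof -
    have "\<eta>\<^sup>2 * (2 * \<delta>\<^sup>2 + \<sigma>\<^sup>2) = \<eta> * (\<eta> * \<mu> * \<epsilon> / 32 + \<epsilon> / 8)"
      using \<eta>(1) unfolding \<delta> \<sigma> by (simp add: field_simps power2_eq_square)
    also have "\<dots> \<le> \<eta> * (1 / 4 * \<epsilon> / 32 + \<epsilon> / 8)"
      using \<eta>\<mu> \<eta>(1) \<epsilon>(1) by (intro mult_left_mono add_right_mono divide_right_mono mult_right_mono) auto
    also have "\<dots> \<le> \<eta> * (\<epsilon> / 5 - \<epsilon> / 16)"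
      using \<eta>(1) \<epsilon>(1) by (intro mult_left_mono) auto
    finally show ?thesis .
  qed
  have regret: "(\<Sum>t<T. v t * e t) \<le> (\<Sum>t<T. v t) * \<epsilon>"
    unfolding v_def
  proof (rule strong_recurrence[OF sc(1) \<epsilon>(1) \<eta>(1) \<eta>\<mu>])
    show "\<epsilon> \<le> \<mu> * a 0" "4 / (\<eta> * \<mu>) * ln (256 * \<mu> * a 0 / \<epsilon>) \<le> real T"
      using \<epsilon> \<open>x \<le> real T\<close> by (simp_all add: a0 x_def)
    show "a t \<ge> 0" for t
      by (simp add: a_def)
    fix t assume "t < T"
    have "a (Suc t) \<le> measure_pmf.expectation P (\<lambda>w. (1 - \<eta> * \<mu>) * (norm (y w t - ystar))\<^sup>2
      - \<eta> * (L (y w t) - L ystar) + 2 * \<eta> * \<delta> * norm (y w t - ystar) + \<eta>\<^sup>2 * (2 * \<delta>\<^sup>2 + \<sigma>\<^sup>2))"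
      unfolding a_def P_def y_def
      by (rule expected_distance_step[OF smooth sc(3) minimizer hierarchy(1) \<open>\<delta> > 0\<close> hierarchy(2) \<eta> _ \<open>t < T\<close>])
         (use base in \<open>simp add: P_def y_def\<close>)
    also have "\<dots> \<le> measure_pmf.expectation P (\<lambda>w. (1 - \<eta> * \<mu>) * (norm (y w t - ystar))\<^sup>2
      - \<eta> / 2 * (L (y w t) - L ystar) + \<eta> * (\<epsilon> / 5))"
    proof (intro integral_mono)
      fix w
      define r where "r = norm (y w t - ystar)"
      have "f ystar = 0"
        using gradient_norm_le_suboptimality[OF smooth minimizer, of ystar] by simp
      then have growth: "\<mu> / 2 * r\<^sup>2 \<le> L (y w t) - L ystar"
        using strongly_convex_gradient_lower_bound[OF sc(3), of f ystar "y w t - ystar"] smooth(2)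
        by (simp add: r_def smooth_with_gradient_def)
      \<comment> \<open>The bias is absorbed by half of the suboptimality, through the quadratic growth of \<open>L\<close>.\<close>
      have "\<mu> * (2 * \<delta> * r) \<le> \<mu> * (\<epsilon> / 16 + \<mu> / 4 * r\<^sup>2)"
        using zero_le_power2[of "2 * \<delta> - \<mu> * r / 2"] \<delta>
        by (simp add: power2_eq_square algebra_simps)
      then have "2 * \<delta> * r \<le> \<epsilon> / 16 + \<mu> / 4 * r\<^sup>2"
        using sc(1) by simp
      with growth have "2 * \<delta> * r \<le> \<epsilon> / 16 + (L (y w t) - L ystar) / 2"
        by argo
      then have "\<eta> * (2 * \<delta> * r) \<le> \<eta> * (\<epsilon> / 16 + (L (y w t) - L ystar) / 2)"
        using \<eta>(1) by (intro mult_left_mono) auto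
      then show "(1 - \<eta> * \<mu>) * (norm (y w t - ystar))\<^sup>2 - \<eta> * (L (y w t) - L ystar)
          + 2 * \<eta> * \<delta> * norm (y w t - ystar) + \<eta>\<^sup>2 * (2 * \<delta>\<^sup>2 + \<sigma>\<^sup>2)
        \<le> (1 - \<eta> * \<mu>) * (norm (y w t - ystar))\<^sup>2 - \<eta> / 2 * (L (y w t) - L ystar) + \<eta> * (\<epsilon> / 5)"
        using noise unfolding r_def[symmetric]
        by (simp add: algebra_simps add_divide_distrib diff_divide_distrib)
    qed simp_all
    also have "\<dots> = (1 - \<eta> * \<mu>) * a t - \<eta> / 2 * e t + \<eta> * (\<epsilon> / 5)"
      unfolding a_def e_def by simp
    finally show "a (Suc t) \<le> (1 - \<eta> * \<mu>) * a t - \<eta> / 2 * e t + \<eta> * (\<epsilon> / 5)" .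
  qed
  have v: "v t > 0" for t
    using \<eta>\<mu> by (simp add: v_def)
  have W: "(\<Sum>t<T. v t) > 0"
    using v \<open>T > 0\<close> by (intro sum_pos) auto
  have "L (geometric_average (1 - \<eta> * \<mu>) T (y w)) - L ystar \<le>
      (1 / sum v {..<T}) * (\<Sum>t<T. v t * (L (y w t) - L ystar))" for w
    using convex_weighted_average[OF convex, of T v "y w" "L ystar"] \<open>T > 0\<close> v
    by (simp add: geometric_average_def v_def)
  then have "measure_pmf.expectation P (\<lambda>w. L (geometric_average (1 - \<eta> * \<mu>) T (y w)) - L ystar) \<le>
      measure_pmf.expectation P (\<lambda>w. (1 / sum v {..<T}) * (\<Sum>t<T. v t * (L (y w t) - L ystar)))"
    by (intro integral_mono) simp_all
  also have "\<dots> = (1 / sum v {..<T}) * (\<Sum>t<T. v t * e t)"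
    unfolding e_def integral_mult_right_zero[symmetric]
    by (subst Bochner_Integration.integral_sum[symmetric]) simp_all
  also have "\<dots> \<le> \<epsilon>"
    using regret W by (simp add: divide_le_eq mult.commute)
  finally show ?thesis .
qed

section \<open>Expected cost of a run\<close>

lemma expected_cost_eq:
  "expected_cost TYPE('a::euclidean_space) \<gamma> c \<delta> \<sigma> cost T =
    real T * optimal_call_cost TYPE('a) \<gamma> c \<delta> \<sigma> cost"
proof -
  define C where "C = ml_const TYPE('a) \<gamma> c \<delta> \<sigma>"
  have "expected_cost TYPE('a) \<gamma> c \<delta> \<sigma> cost T =
      (\<Sum>t<T. measure_pmf.expectation (run_draws TYPE('a) \<gamma> c \<delta> \<sigma> T) (\<lambda>w. call_cost \<gamma> c \<delta> C cost (w t)))"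
    unfolding expected_cost_def C_def
    by (rule Bochner_Integration.integral_sum) (rule integrable_measure_pmf_finite[OF finite_run_draws])
  also have "\<dots> = (\<Sum>t<T. optimal_call_cost TYPE('a) \<gamma> c \<delta> \<sigma> cost)"
    unfolding run_draws_def optimal_call_cost_def C_def
    by (intro sum.cong refl expectation_Pi_pmf_component) auto
  finally show ?thesis by simp
qed

lemma expected_cost_le:
  assumes "optimal_call_cost TYPE('a::euclidean_space) \<gamma> c \<delta> \<sigma> cost \<le> B" "0 \<le> B" "real T \<le> N"
  shows "expected_cost TYPE('a) \<gamma> c \<delta> \<sigma> cost T \<le> N * B"
proof -
  have "real T * optimal_call_cost TYPE('a) \<gamma> c \<delta> \<sigma> cost \<le> real T * B"
    using assms(1) by (intro mult_left_mono) auto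
  also have "\<dots> \<le> N * B"
    using assms(2,3) by (intro mult_right_mono)
  finally show ?thesis
    by (simp add: expected_cost_eq)
qed

lemma log_2_sqrt_le:
  assumes "x \<ge> 1"
  shows "log 2 (sqrt x) \<le> ln x"
proof -
  have "1 / 2 \<le> ln (2 :: real)"
    using ln2_ge_two_thirds by simp
  then have "ln x * (1 / 2) \<le> ln x * ln 2"
    using assms by (intro mult_left_mono) auto
  then show ?thesis
    using assms by (simp add: log_def ln_sqrt divide_le_eq)
qed

lemma rate_const_ge:
  assumes "\<gamma> \<noteq> 2" "K \<le> 2 ^ 30 * 32 powr \<gamma>"
  shows "K / (1 - 2 powr (- \<bar>\<gamma> / 2 - 1\<bar>))\<^sup>2 \<le> rate_const \<gamma>"
  using assms by (simp add: rate_const_def divide_right_mono)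

text \<open>The number of calls times the compute of one call, in the three regimes. The condition
  \<open>\<eta> \<le> d0\<^sup>2 / \<epsilon>\<close> for \<open>\<gamma> > 2\<close> and the condition on \<open>\<epsilon>\<close> for \<open>\<gamma> < 2\<close> keep the rounding of \<open>T\<close> to an integer
  from dominating \<open>T\<close>.\<close>

lemma expected_cost_convex:
  fixes \<gamma> c \<beta> \<eta> \<epsilon> d0 :: real
  assumes pos: "\<beta> > 0" "d0 > 0" "\<gamma> > 0" "c > 0" "\<epsilon> > 0" "\<eta> > 0"
    and cost: "\<And>k. cost k \<le> c powr \<gamma> * 2 powr (\<gamma> * of_int k)"
    and \<eta>_steep: "\<gamma> > 2 \<Longrightarrow> \<eta> \<le> min (1 / (4 * \<beta>)) (d0\<^sup>2 / \<epsilon>)"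
    and \<eta>_flat: "\<gamma> \<le> 2 \<Longrightarrow> \<eta> = 1 / (4 * \<beta>)"
    and \<epsilon>_flat: "\<gamma> < 2 \<Longrightarrow> \<epsilon> \<le> 4 * \<beta> * d0\<^sup>2"
  shows "expected_cost TYPE('a::euclidean_space) \<gamma> c (\<delta>_convex d0 \<epsilon>) (\<sigma>_convex \<eta> \<epsilon>) cost (T_convex d0 \<eta> \<epsilon>)
    \<le> rate_const \<gamma> * convex_rate \<gamma> c \<beta> d0 \<epsilon>"
proof -
  define \<delta> where "\<delta> = \<delta>_convex d0 \<epsilon>"
  define \<sigma> where "\<sigma> = \<sigma>_convex \<eta> \<epsilon>"
  define T where "T = T_convex d0 \<eta> \<epsilon>"
  define Q where "Q = (1 - 2 powr (- \<bar>\<gamma> / 2 - 1\<bar>))\<^sup>2"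
  have "Q \<ge> 0" by (simp add: Q_def)
  have "\<delta> > 0" "\<sigma> > 0" and \<delta>: "2 / \<delta> = 32 * (d0 / \<epsilon>)" and \<sigma>: "\<sigma>\<^sup>2 = \<epsilon> / (4 * \<eta>)"
    using pos by (simp_all add: \<delta>_def \<delta>_convex_def \<sigma>_def \<sigma>_convex_def)
  have T: "real T \<le> 4 * d0\<^sup>2 / (\<eta> * \<epsilon>) + 1"
  proof -
    have "4 * d0\<^sup>2 / (\<eta> * \<epsilon>) \<ge> 0" using pos by simp
    then show ?thesis unfolding T_def T_convex_def by linarith
  qed
  define R where "R = \<beta> * d0\<^sup>2 / \<epsilon>"
  have "R > 0" using pos by (simp add: R_def)
  have T_flat: "real T \<le> 16 * R + 1" if "\<gamma> \<le> 2"
    using T that \<eta>_flat pos by (simp add: R_def field_simps)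
  have "expected_cost TYPE('a) \<gamma> c \<delta> \<sigma> cost T \<le> rate_const \<gamma> * convex_rate \<gamma> c \<beta> d0 \<epsilon>"
  proof (cases "\<gamma> > 2")
    case steep: True
    define Y where "Y = d0\<^sup>2 / (\<eta> * \<epsilon>)"
    have "1 \<le> Y"
      using \<eta>_steep steep pos by (simp add: Y_def field_simps)
    moreover have "real T \<le> 4 * Y + 1"
      using T by (simp add: Y_def)
    ultimately have "real T \<le> 5 * (d0\<^sup>2 / (\<eta> * \<epsilon>))"
      unfolding Y_def[symmetric] by linarith
    then have "expected_cost TYPE('a) \<gamma> c \<delta> \<sigma> cost T \<le>
        5 * (d0\<^sup>2 / (\<eta> * \<epsilon>)) * (27 * c powr \<gamma> * (2 / \<delta>) powr (\<gamma> - 2) / (\<sigma>\<^sup>2 * Q))"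
      using optimal_call_cost_le_steep[OF steep \<open>\<delta> > 0\<close> \<open>\<sigma> > 0\<close> cost, where 'a = 'a] \<open>Q \<ge> 0\<close>
      unfolding Q_def by (intro expected_cost_le) auto
    also have "(2 / \<delta>) powr (\<gamma> - 2) = (32 * (d0 / \<epsilon>)) powr \<gamma> / (32 * (d0 / \<epsilon>))\<^sup>2"
      unfolding \<delta> using pos by (simp add: powr_diff powr_numeral)
    also have "\<dots> = 32 powr \<gamma> * (d0 / \<epsilon>) powr \<gamma> / (1024 * (d0 / \<epsilon>)\<^sup>2)"
      by (simp only: powr_mult power_mult_distrib) simp
    also have "5 * (d0\<^sup>2 / (\<eta> * \<epsilon>)) * (27 * c powr \<gamma> * (32 powr \<gamma> * (d0 / \<epsilon>) powr \<gamma> / (1024 * (d0 / \<epsilon>)\<^sup>2)) / (\<sigma>\<^sup>2 * Q))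
        = (135 / 256 * 32 powr \<gamma> / Q) * (c powr \<gamma> * (d0 / \<epsilon>) powr \<gamma>)"
      unfolding \<sigma> using pos by (simp add: field_simps power2_eq_square)
    also have "\<dots> \<le> rate_const \<gamma> * (c powr \<gamma> * (d0 / \<epsilon>) powr \<gamma>)"
      unfolding Q_def using steep by (intro mult_right_mono rate_const_ge) auto
    also have "c powr \<gamma> * (d0 / \<epsilon>) powr \<gamma> = convex_rate \<gamma> c \<beta> d0 \<epsilon>"
      using steep pos by (simp add: convex_rate_def flip: powr_mult)
    finally show ?thesis .
  next
    case not_steep: False
    then have \<eta>: "\<eta> = 1 / (4 * \<beta>)"
      using \<eta>_flat by simp
    have \<sigma>2: "\<sigma>\<^sup>2 = \<epsilon> * \<beta>"
      unfolding \<sigma> \<eta> using pos by simp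
    then have \<sigma>_sqrt: "\<sigma> = sqrt (\<epsilon> * \<beta>)"
      using \<open>\<sigma> > 0\<close> by (metis less_imp_le real_sqrt_abs abs_of_nonneg)
    show ?thesis
    proof (cases "\<gamma> = 2")
      case critical: True
      have rate: "convex_rate \<gamma> c \<beta> d0 \<epsilon> = c\<^sup>2 * d0\<^sup>2 / \<epsilon>\<^sup>2 * (log1 R)\<^sup>2"
        using critical pos by (simp add: convex_rate_def R_def powr_minus_divide powr_numeral)
      have "log1 R \<ge> 1" by (simp add: log1_def)
      have cost2: "cost k \<le> c powr 2 * 2 powr (2 * of_int k)" for k
        using cost[of k] critical by simp
      show ?thesis
      \<comment> \<open>For \<open>R \<le> 1\<close> there are at most 17 calls, and charging each for the finest level suffices.\<close>
      proof (cases "R \<le> 1")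
        case True
        have "real T \<le> 17"
          using T_flat True critical by simp
        then have "expected_cost TYPE('a) \<gamma> c \<delta> \<sigma> cost T \<le> 17 * (c powr \<gamma> * (2 / \<delta>) powr \<gamma>)"
          by (intro expected_cost_le optimal_call_cost_le_finest pos cost \<open>\<delta> > 0\<close>) auto
        also have "\<dots> = 17408 * (c\<^sup>2 * d0\<^sup>2 / \<epsilon>\<^sup>2) * 1"
          unfolding \<delta> critical using pos by (simp add: powr_numeral power_mult_distrib power_divide)
        also have "\<dots> \<le> 2 ^ 40 * (c\<^sup>2 * d0\<^sup>2 / \<epsilon>\<^sup>2) * (log1 R)\<^sup>2"
          using \<open>log1 R \<ge> 1\<close> by (intro mult_mono) (auto simp: one_le_power)
        finally show ?thesis
          by (simp add: rate[unfolded critical] rate_const_def critical)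
      next
        case False
        have "\<sigma> / \<delta> = 16 * sqrt R"
        proof (rule power2_eq_imp_eq)
          show "(\<sigma> / \<delta>)\<^sup>2 = (16 * sqrt R)\<^sup>2"
            using pos \<open>R > 0\<close> unfolding power_divide power_mult_distrib \<sigma>2
            by (simp add: \<delta>_def \<delta>_convex_def) (simp add: R_def field_simps power2_eq_square)
        qed (use \<open>\<delta> > 0\<close> \<open>\<sigma> > 0\<close> \<open>R > 0\<close> in auto)
        then have "log 2 (\<sigma> / \<delta>) = 4 + log 2 (sqrt R)"
          using \<open>R > 0\<close> log_pow_cancel[of 2 4] by (simp add: log_mult)
        also have "\<dots> \<le> 4 + log1 R"
          using log_2_sqrt_le[of R] False by (simp add: log1_def)
        finally have x: "1 \<le> 6 * log1 R" "1 + log 2 (\<sigma> / \<delta>) \<le> 6 * log1 R"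
          using \<open>log1 R \<ge> 1\<close> by auto
        have "real T \<le> 17 * R"
          using T_flat False critical by simp
        then have "expected_cost TYPE('a) \<gamma> c \<delta> \<sigma> cost T \<le> 17 * R * (27 * c powr 2 * (6 * log1 R)\<^sup>2 / \<sigma>\<^sup>2)"
          unfolding critical
          by (intro expected_cost_le optimal_call_cost_le_critical cost2 x \<open>\<delta> > 0\<close> \<open>\<sigma> > 0\<close>) auto
        also have "\<dots> = 16524 * (c\<^sup>2 * d0\<^sup>2 / \<epsilon>\<^sup>2 * (log1 R)\<^sup>2)"
          unfolding \<sigma>2 R_def using pos by (simp add: powr_numeral power_mult_distrib field_simps power2_eq_square)
        also have "\<dots> \<le> 2 ^ 40 * (c\<^sup>2 * d0\<^sup>2 / \<epsilon>\<^sup>2 * (log1 R)\<^sup>2)"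
          by (intro mult_right_mono) auto
        finally show ?thesis
          by (simp add: rate[unfolded critical] rate_const_def critical)
      qed
    next
      case False
      with not_steep have flat: "\<gamma> < 2" by simp
      have "1 \<le> 4 * R"
        using \<epsilon>_flat[OF flat] pos by (simp add: R_def field_simps)
      then have "real T \<le> 20 * R"
        using T_flat flat by simp
      then have "expected_cost TYPE('a) \<gamma> c \<delta> \<sigma> cost T \<le> 20 * R * (27 * c powr \<gamma> * \<sigma> powr (- \<gamma>) / Q)"
        using \<open>Q \<ge> 0\<close> unfolding Q_def
        by (intro expected_cost_le optimal_call_cost_le_flat pos cost flat \<open>\<delta> > 0\<close> \<open>\<sigma> > 0\<close>) auto
      also have "\<sigma> powr (- \<gamma>) = \<epsilon> powr (- \<gamma> / 2) * \<beta> powr (- \<gamma> / 2)"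
        unfolding \<sigma>_sqrt using pos by (simp add: powr_half_sqrt[symmetric] powr_powr powr_mult)
      also have "20 * R * (27 * c powr \<gamma> * (\<epsilon> powr (- \<gamma> / 2) * \<beta> powr (- \<gamma> / 2)) / Q)
          = (540 / Q) * (c powr \<gamma> * d0\<^sup>2 * (\<beta> powr 1 * \<beta> powr (- \<gamma> / 2)) * (\<epsilon> powr (- 1) * \<epsilon> powr (- \<gamma> / 2)))"
        unfolding R_def using pos by (simp add: powr_minus_divide mult_ac)
      also have "\<dots> = (540 / Q) * convex_rate \<gamma> c \<beta> d0 \<epsilon>"
        unfolding powr_add[symmetric] using flat by (simp add: convex_rate_def)
      also have "\<dots> \<le> rate_const \<gamma> * convex_rate \<gamma> c \<beta> d0 \<epsilon>"
      proof (intro mult_right_mono)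
        have "540 * 1 \<le> 2 ^ 30 * 32 powr \<gamma>"
          using \<open>\<gamma> > 0\<close> by (intro mult_mono) (auto intro: ge_one_powr_ge_zero)
        then show "540 / Q \<le> rate_const \<gamma>"
          unfolding Q_def using False by (intro rate_const_ge) auto
      qed (use flat in \<open>simp add: convex_rate_def\<close>)
      finally show ?thesis .
    qed
  qed
  then show ?thesis
    by (simp add: T_def \<delta>_def \<sigma>_def)
qed

text \<open>Rounding \<open>T\<close> is harmless here, since \<open>\<eta> * \<mu> \<le> 1 / 4\<close> and \<open>\<epsilon> \<le> \<mu> * d0\<^sup>2\<close> make the number
  before rounding larger than 1.\<close>

lemma expected_cost_strongly_convex:
  fixes \<gamma> c \<beta> \<mu> \<eta> \<epsilon> d0 :: real
  assumes pos: "\<beta> > 0" "\<gamma> > 0" "c > 0" "\<epsilon> > 0" "\<eta> > 0"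
    and \<mu>: "0 < \<mu>" "\<mu> \<le> \<beta>" "\<epsilon> \<le> \<mu> * d0\<^sup>2"
    and cost: "\<And>k. cost k \<le> c powr \<gamma> * 2 powr (\<gamma> * of_int k)"
    and \<eta>_le: "\<eta> \<le> 1 / (4 * \<beta>)"
    and \<eta>_flat: "\<gamma> \<le> 2 \<Longrightarrow> \<eta> = 1 / (4 * \<beta>)"
  shows "expected_cost TYPE('a::euclidean_space) \<gamma> c (\<delta>_strong \<mu> \<epsilon>) (\<sigma>_strong \<eta> \<epsilon>) cost (T_strong \<mu> d0 \<eta> \<epsilon>)
    \<le> rate_const \<gamma> * (1 + ln (\<mu> * d0\<^sup>2 / \<epsilon>)) * strong_rate \<gamma> c \<beta> \<mu> \<epsilon>"
proof -
  define \<delta> where "\<delta> = \<delta>_strong \<mu> \<epsilon>"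
  define \<sigma> where "\<sigma> = \<sigma>_strong \<eta> \<epsilon>"
  define T where "T = T_strong \<mu> d0 \<eta> \<epsilon>"
  define Q where "Q = (1 - 2 powr (- \<bar>\<gamma> / 2 - 1\<bar>))\<^sup>2"
  have "Q \<ge> 0" by (simp add: Q_def)
  define s where "s = sqrt (\<mu> * \<epsilon>)"
  have "s > 0" and s2: "s\<^sup>2 = \<mu> * \<epsilon>"
    using pos \<mu> by (simp_all add: s_def)
  have "\<delta> > 0" "\<sigma> > 0" and \<delta>: "2 / \<delta> = 16 / s" and \<sigma>: "\<sigma>\<^sup>2 = \<epsilon> / (8 * \<eta>)"
    using pos \<mu> by (simp_all add: \<delta>_def \<delta>_strong_def \<sigma>_def \<sigma>_strong_def s_def)
  define l where "l = 1 + ln (\<mu> * d0\<^sup>2 / \<epsilon>)"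
  have ratio: "\<mu> * d0\<^sup>2 / \<epsilon> \<ge> 1"
    using \<mu> pos by simp
  then have "l \<ge> 1"
    by (simp add: l_def)
  have \<eta>\<mu>: "\<eta> * \<mu> \<le> 1 / 4"
  proof -
    have "\<eta> * \<mu> \<le> 1 / (4 * \<beta>) * \<beta>"
      using \<eta>_le \<mu> pos by (intro mult_mono) auto
    then show ?thesis using pos by simp
  qed
  have T: "real T \<le> 33 * l / (\<eta> * \<mu>)"
  proof -
    define x where "x = 4 / (\<eta> * \<mu>) * ln (256 * (\<mu> * d0\<^sup>2 / \<epsilon>))"
    have "ln (256 * (\<mu> * d0\<^sup>2 / \<epsilon>)) = ln (2 ^ 8) + ln (\<mu> * d0\<^sup>2 / \<epsilon>)"
      using ratio by (subst ln_mult) auto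
    also have "ln ((2 :: real) ^ 8) = 8 * ln 2"
      using ln_realpow[of 2 8] by simp
    also have "8 * ln 2 + ln (\<mu> * d0\<^sup>2 / \<epsilon>) \<le> 8 * l"
      using ln_2_less_1 ratio unfolding l_def
      by (smt (verit) ln_ge_zero)
    finally have "x \<le> 4 / (\<eta> * \<mu>) * (8 * l)"
      unfolding x_def using pos \<mu> by (intro mult_left_mono) auto
    moreover have "1 \<le> l / (\<eta> * \<mu>)"
      using \<open>l \<ge> 1\<close> \<eta>\<mu> pos \<mu> by (simp add: le_divide_eq)
    moreover have "x \<ge> 0"
      unfolding x_def using ratio pos \<mu> by (intro mult_nonneg_nonneg ln_ge_zero) auto
    moreover have "T = nat \<lceil>x\<rceil>"
      unfolding T_def T_strong_def x_def by (simp add: mult.assoc)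
    ultimately show ?thesis
      by simp linarith
  qed
  define \<kappa> where "\<kappa> = \<beta> / \<mu>"
  have "\<kappa> \<ge> 1"
    using \<mu> by (simp add: \<kappa>_def)
  have T_flat: "real T \<le> 132 * l * \<kappa>" if "\<gamma> \<le> 2"
    using T that \<eta>_flat pos by (simp add: \<kappa>_def field_simps)
  have "expected_cost TYPE('a) \<gamma> c \<delta> \<sigma> cost T \<le> rate_const \<gamma> * l * strong_rate \<gamma> c \<beta> \<mu> \<epsilon>"
  proof (cases "\<gamma> > 2")
    case steep: True
    have "expected_cost TYPE('a) \<gamma> c \<delta> \<sigma> cost T \<le>
        33 * l / (\<eta> * \<mu>) * (27 * c powr \<gamma> * (2 / \<delta>) powr (\<gamma> - 2) / (\<sigma>\<^sup>2 * Q))"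
      using optimal_call_cost_le_steep[OF steep \<open>\<delta> > 0\<close> \<open>\<sigma> > 0\<close> cost, where 'a = 'a] \<open>Q \<ge> 0\<close> T
      unfolding Q_def by (intro expected_cost_le) auto
    also have "(2 / \<delta>) powr (\<gamma> - 2) = 16 powr \<gamma> * (1 / s) powr \<gamma> / (256 / (\<mu> * \<epsilon>))"
      unfolding \<delta> using \<open>s > 0\<close> s2
      by (simp add: powr_diff powr_numeral power_divide flip: powr_mult)
    also have "33 * l / (\<eta> * \<mu>) * (27 * c powr \<gamma> * (16 powr \<gamma> * (1 / s) powr \<gamma> / (256 / (\<mu> * \<epsilon>))) / (\<sigma>\<^sup>2 * Q))
        = (891 / 32 * 16 powr \<gamma> / Q) * (l * (c powr \<gamma> * (1 / s) powr \<gamma>))"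
      unfolding \<sigma> using pos \<mu> by (simp add: field_simps)
    also have "\<dots> \<le> rate_const \<gamma> * (l * (c powr \<gamma> * (1 / s) powr \<gamma>))"
      unfolding Q_def using steep \<open>l \<ge> 1\<close>
      by (intro mult_right_mono rate_const_ge mult_mono powr_mono2) auto
    also have "c powr \<gamma> * (1 / s) powr \<gamma> = strong_rate \<gamma> c \<beta> \<mu> \<epsilon>"
      using steep by (simp add: strong_rate_def s_def flip: powr_mult)
    finally show ?thesis by (simp add: mult.assoc)
  next
    case not_steep: False
    then have \<eta>: "\<eta> = 1 / (4 * \<beta>)"
      using \<eta>_flat by simp
    have \<sigma>2: "\<sigma>\<^sup>2 = \<epsilon> * \<beta> / 2"
      unfolding \<sigma> \<eta> using pos by simp
    then have \<sigma>_sqrt: "\<sigma> = sqrt (\<epsilon> * \<beta> / 2)"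
      using \<open>\<sigma> > 0\<close> by (metis less_imp_le real_sqrt_abs abs_of_nonneg)
    show ?thesis
    proof (cases "\<gamma> = 2")
      case critical: True
      have rate: "strong_rate \<gamma> c \<beta> \<mu> \<epsilon> = c\<^sup>2 / (\<mu> * \<epsilon>) * (log1 \<kappa>)\<^sup>2"
        using critical pos \<mu> by (simp add: strong_rate_def \<kappa>_def powr_minus_divide)
      have "log1 \<kappa> \<ge> 1" by (simp add: log1_def)
      have cost2: "cost k \<le> c powr 2 * 2 powr (2 * of_int k)" for k
        using cost[of k] critical by simp
      have "\<sigma> / \<delta> \<le> 8 * sqrt \<kappa>"
      proof (rule power2_le_imp_le)
        show "(\<sigma> / \<delta>)\<^sup>2 \<le> (8 * sqrt \<kappa>)\<^sup>2"
          using pos \<mu> \<open>\<kappa> \<ge> 1\<close> s2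
          by (simp add: power_divide power_mult_distrib \<sigma>2 \<kappa>_def \<delta>_def \<delta>_strong_def field_simps)
      qed (use \<open>\<kappa> \<ge> 1\<close> in auto)
      then have "log 2 (\<sigma> / \<delta>) \<le> log 2 (2 ^ 3 * sqrt \<kappa>)"
        using \<open>\<delta> > 0\<close> \<open>\<sigma> > 0\<close> \<open>\<kappa> \<ge> 1\<close> by (subst log_le_cancel_iff) auto
      also have "\<dots> = 3 + log 2 (sqrt \<kappa>)"
        using \<open>\<kappa> \<ge> 1\<close> log_pow_cancel[of 2 3] by (subst log_mult) auto
      also have "\<dots> \<le> 3 + log1 \<kappa>"
        using log_2_sqrt_le[OF \<open>\<kappa> \<ge> 1\<close>] by (simp add: log1_def)
      finally have x: "1 \<le> 5 * log1 \<kappa>" "1 + log 2 (\<sigma> / \<delta>) \<le> 5 * log1 \<kappa>"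
        using \<open>log1 \<kappa> \<ge> 1\<close> by auto
      have "expected_cost TYPE('a) \<gamma> c \<delta> \<sigma> cost T \<le> 132 * l * \<kappa> * (27 * c powr 2 * (5 * log1 \<kappa>)\<^sup>2 / \<sigma>\<^sup>2)"
        using T_flat unfolding critical
        by (intro expected_cost_le optimal_call_cost_le_critical cost2 x \<open>\<delta> > 0\<close> \<open>\<sigma> > 0\<close>) auto
      also have "\<dots> = 178200 * (l * (c\<^sup>2 / (\<mu> * \<epsilon>) * (log1 \<kappa>)\<^sup>2))"
        unfolding \<sigma>2 \<kappa>_def using pos \<mu> by (simp add: powr_numeral power_mult_distrib)
      also have "\<dots> \<le> 2 ^ 40 * (l * (c\<^sup>2 / (\<mu> * \<epsilon>) * (log1 \<kappa>)\<^sup>2))"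
        using \<open>l \<ge> 1\<close> pos \<mu> by (intro mult_right_mono) auto
      finally show ?thesis
        by (simp add: rate[unfolded critical] rate_const_def critical mult.assoc)
    next
      case False
      with not_steep have flat: "\<gamma> < 2" by simp
      have "expected_cost TYPE('a) \<gamma> c \<delta> \<sigma> cost T \<le> 132 * l * \<kappa> * (27 * c powr \<gamma> * \<sigma> powr (- \<gamma>) / Q)"
        using \<open>Q \<ge> 0\<close> T_flat flat unfolding Q_def
        by (intro expected_cost_le optimal_call_cost_le_flat pos cost flat \<open>\<delta> > 0\<close> \<open>\<sigma> > 0\<close>) auto
      also have "\<sigma> powr (- \<gamma>) = 2 powr (\<gamma> / 2) * ((\<mu> * \<epsilon>) * \<kappa>) powr (- \<gamma> / 2)"
      proof -
        have "\<sigma> powr (- \<gamma>) = ((1 / 2) * ((\<mu> * \<epsilon>) * \<kappa>)) powr (- \<gamma> / 2)"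
          unfolding \<sigma>_sqrt using pos \<mu>
          by (simp add: \<kappa>_def powr_half_sqrt[symmetric] powr_powr)
        also have "\<dots> = (1 / 2) powr (- \<gamma> / 2) * ((\<mu> * \<epsilon>) * \<kappa>) powr (- \<gamma> / 2)"
          by (rule powr_mult)
        also have "(1 / 2) powr (- \<gamma> / 2) = 2 powr (\<gamma> / 2)"
          by (simp add: powr_divide powr_minus_divide)
        finally show ?thesis .
      qed
      also have "132 * l * \<kappa> * (27 * c powr \<gamma> * (2 powr (\<gamma> / 2) * ((\<mu> * \<epsilon>) * \<kappa>) powr (- \<gamma> / 2)) / Q)
          = (3564 * 2 powr (\<gamma> / 2) / Q) * (l * (c powr \<gamma> * (\<mu> * \<epsilon>) powr (- \<gamma> / 2) * (\<kappa> powr 1 * \<kappa> powr (- \<gamma> / 2))))"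
        using pos \<mu> \<open>\<kappa> \<ge> 1\<close> by (simp add: powr_mult)
      also have "\<dots> = (3564 * 2 powr (\<gamma> / 2) / Q) * (l * strong_rate \<gamma> c \<beta> \<mu> \<epsilon>)"
        unfolding powr_add[symmetric] using flat by (simp add: strong_rate_def \<kappa>_def)
      also have "\<dots> \<le> rate_const \<gamma> * (l * strong_rate \<gamma> c \<beta> \<mu> \<epsilon>)"
      proof (intro mult_right_mono)
        have "2 powr (\<gamma> / 2) \<le> (32 :: real) powr (\<gamma> / 2)"
          using \<open>\<gamma> > 0\<close> by (intro powr_mono2) auto
        also have "\<dots> \<le> 32 powr \<gamma>"
          using \<open>\<gamma> > 0\<close> by (intro powr_mono) auto
        finally have "3564 * 2 powr (\<gamma> / 2) \<le> 2 ^ 30 * 32 powr \<gamma>"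
          by (intro mult_mono) auto
        then show "3564 * 2 powr (\<gamma> / 2) / Q \<le> rate_const \<gamma>"
          unfolding Q_def using False by (intro rate_const_ge) auto
      qed (use flat \<open>l \<ge> 1\<close> in \<open>simp add: strong_rate_def\<close>)
      finally show ?thesis by (simp add: mult.assoc)
    qed
  qed
  then show ?thesis
    by (simp add: T_def \<delta>_def \<sigma>_def l_def)
qed

section \<open>The deterministic comparison\<close>

text \<open>The number of calls is \<open>16 * \<beta> * d0\<^sup>2 / \<epsilon>\<close> rounded up, and rounding at most doubles it; each call costs
  \<open>(16 * c * d0 / \<epsilon>) powr \<gamma>\<close>.\<close>

lemma deterministic_cost_bounds:
  fixes \<gamma> :: real
  assumes "\<beta> > 0" "d0 > 0" "c > 0" "0 < \<epsilon>" "\<epsilon> \<le> \<beta> * d0\<^sup>2"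
  defines "r \<equiv> \<beta> * d0\<^sup>2 / \<epsilon> * (c * d0 / \<epsilon>) powr \<gamma>"
  shows "16 powr (\<gamma> + 1) * r \<le> deterministic_cost \<gamma> c \<beta> d0 \<epsilon>"
    and "deterministic_cost \<gamma> c \<beta> d0 \<epsilon> \<le> 2 * 16 powr (\<gamma> + 1) * r"
proof -
  define R where "R = \<beta> * d0\<^sup>2 / \<epsilon>"
  have "R \<ge> 1" using assms by (simp add: R_def)
  define N where "N = T_convex d0 (1 / (4 * \<beta>)) \<epsilon>"
  have "N = nat \<lceil>16 * R\<rceil>"
    using assms by (simp add: N_def T_convex_def R_def mult.commute)
  then have N: "16 * R \<le> real N" "real N \<le> 32 * R"
    using \<open>R \<ge> 1\<close> by linarith+
  have "c / \<delta>_convex d0 \<epsilon> = 16 * (c * d0 / \<epsilon>)"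
    by (simp add: \<delta>_convex_def)
  then have "(c / \<delta>_convex d0 \<epsilon>) powr \<gamma> = 16 powr \<gamma> * (c * d0 / \<epsilon>) powr \<gamma>"
    by (simp only: powr_mult)
  then have det: "deterministic_cost \<gamma> c \<beta> d0 \<epsilon> = real N * (16 powr \<gamma> * (c * d0 / \<epsilon>) powr \<gamma>)"
    by (simp add: deterministic_cost_def N_def)
  have r: "16 powr (\<gamma> + 1) * r = 16 * R * (16 powr \<gamma> * (c * d0 / \<epsilon>) powr \<gamma>)"
    by (simp add: r_def R_def powr_add)
  show "16 powr (\<gamma> + 1) * r \<le> deterministic_cost \<gamma> c \<beta> d0 \<epsilon>"
    unfolding r det using N by (intro mult_right_mono) auto
  have "deterministic_cost \<gamma> c \<beta> d0 \<epsilon> \<le> 32 * R * (16 powr \<gamma> * (c * d0 / \<epsilon>) powr \<gamma>)"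
    unfolding det using N by (intro mult_right_mono) auto
  also have "\<dots> = 2 * (16 powr (\<gamma> + 1) * r)"
    unfolding r by simp
  finally show "deterministic_cost \<gamma> c \<beta> d0 \<epsilon> \<le> 2 * 16 powr (\<gamma> + 1) * r"
    by simp
qed

lemma deterministic_cost_bigtheta:
  assumes "\<beta> > 0" "d0 > 0" "c > 0"
  shows "deterministic_cost \<gamma> c \<beta> d0
      \<in> \<Theta>[at_right 0](\<lambda>\<epsilon>. \<beta> * d0\<^sup>2 * \<epsilon> powr (-1) * (c * d0 / \<epsilon>) powr \<gamma>)"
proof (rule bigthetaI')
  show "(16 powr (\<gamma> + 1) :: real) > 0" "(2 * 16 powr (\<gamma> + 1) :: real) > 0"
    by simp_all
  show "\<forall>\<^sub>F \<epsilon> in at_right 0.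
      16 powr (\<gamma> + 1) * norm (\<beta> * d0\<^sup>2 * \<epsilon> powr (-1) * (c * d0 / \<epsilon>) powr \<gamma>) \<le> norm (deterministic_cost \<gamma> c \<beta> d0 \<epsilon>) \<and>
      norm (deterministic_cost \<gamma> c \<beta> d0 \<epsilon>) \<le> 2 * 16 powr (\<gamma> + 1) * norm (\<beta> * d0\<^sup>2 * \<epsilon> powr (-1) * (c * d0 / \<epsilon>) powr \<gamma>)"
    unfolding eventually_at_right_field
  proof (intro exI[of _ "\<beta> * d0\<^sup>2"] conjI allI impI)
    fix \<epsilon> assume \<epsilon>: "0 < \<epsilon>" "\<epsilon> < \<beta> * d0\<^sup>2"
    have r: "norm (\<beta> * d0\<^sup>2 * \<epsilon> powr (-1) * (c * d0 / \<epsilon>) powr \<gamma>) = \<beta> * d0\<^sup>2 / \<epsilon> * (c * d0 / \<epsilon>) powr \<gamma>"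
      using \<epsilon> assms by (simp add: powr_minus_divide)
    have d: "norm (deterministic_cost \<gamma> c \<beta> d0 \<epsilon>) = deterministic_cost \<gamma> c \<beta> d0 \<epsilon>"
      by (simp add: deterministic_cost_def)
    show "16 powr (\<gamma> + 1) * norm (\<beta> * d0\<^sup>2 * \<epsilon> powr (-1) * (c * d0 / \<epsilon>) powr \<gamma>) \<le> norm (deterministic_cost \<gamma> c \<beta> d0 \<epsilon>)"
      and "norm (deterministic_cost \<gamma> c \<beta> d0 \<epsilon>) \<le> 2 * 16 powr (\<gamma> + 1) * norm (\<beta> * d0\<^sup>2 * \<epsilon> powr (-1) * (c * d0 / \<epsilon>) powr \<gamma>)"
      unfolding r d using deterministic_cost_bounds[OF assms \<epsilon>(1), of \<gamma>] \<epsilon>(2) by simp_all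
  qed (use assms in simp)
qed

lemma deterministic_cost_bigtheta_accuracy:
  assumes "\<beta> > 0" "d0 > 0" "c > 0"
  shows "deterministic_cost \<gamma> c \<beta> d0 \<in> \<Theta>[at_right 0](\<lambda>\<epsilon>. \<epsilon> powr (- (\<gamma> + 1)))"
proof -
  have "\<forall>\<^sub>F \<epsilon> in at_right 0. \<beta> * d0\<^sup>2 * \<epsilon> powr (-1) * (c * d0 / \<epsilon>) powr \<gamma> =
      \<beta> * d0\<^sup>2 * (c * d0) powr \<gamma> * \<epsilon> powr (- (\<gamma> + 1))"
    unfolding eventually_at_right_field
  proof (intro exI[of _ 1] conjI allI impI)
    fix \<epsilon> :: real assume "0 < \<epsilon>"
    then have "(c * d0 / \<epsilon>) powr \<gamma> = (c * d0) powr \<gamma> * \<epsilon> powr (- \<gamma>)"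
      using assms by (simp add: powr_divide powr_minus_divide)
    moreover have "\<epsilon> powr (- (\<gamma> + 1)) = \<epsilon> powr (-1) * \<epsilon> powr (- \<gamma>)"
      unfolding powr_add[symmetric] by (simp add: add.commute)
    ultimately show "\<beta> * d0\<^sup>2 * \<epsilon> powr (-1) * (c * d0 / \<epsilon>) powr \<gamma> =
        \<beta> * d0\<^sup>2 * (c * d0) powr \<gamma> * \<epsilon> powr (- (\<gamma> + 1))"
      by simp
  qed simp
  then have "(\<lambda>\<epsilon>. \<beta> * d0\<^sup>2 * \<epsilon> powr (-1) * (c * d0 / \<epsilon>) powr \<gamma>) \<in>
      \<Theta>[at_right 0](\<lambda>\<epsilon>. \<beta> * d0\<^sup>2 * (c * d0) powr \<gamma> * \<epsilon> powr (- (\<gamma> + 1)))"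
    by (rule bigthetaI_cong)
  also have "(\<lambda>\<epsilon>. \<beta> * d0\<^sup>2 * (c * d0) powr \<gamma> * \<epsilon> powr (- (\<gamma> + 1))) \<in> \<Theta>[at_right 0](\<lambda>\<epsilon>. \<epsilon> powr (- (\<gamma> + 1)))"
    using assms by simp
  finally show ?thesis
    using deterministic_cost_bigtheta[OF assms] landau_theta.trans by blast
qed

section \<open>The convergence and cost theorem\<close>

theorem theorem4:
  fixes L :: "'a::euclidean_space \<Rightarrow> real"
    and f :: "'a \<Rightarrow> 'a"
    and A :: "int \<Rightarrow> 'a \<Rightarrow> 'a"
    and cost :: "int \<Rightarrow> real"
    and y0 ystar :: 'a
    and \<beta> \<gamma> c d0 \<epsilon> \<eta> :: real
  assumes convex: "convex_on UNIV L"
    and smooth: "\<beta> > 0" "smooth_with_gradient \<beta> L f"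
    and minimizer: "\<And>y. L ystar \<le> L y"
    and d0: "d0 = norm (y0 - ystar)" "d0 > 0"
    and hierarchy: "\<gamma> > 0" "c > 0" "dyadic_hierarchy \<gamma> c f A cost"
    and \<epsilon>: "\<epsilon> > 0"
    and \<eta>: "\<eta> > 0"
      "\<gamma> > 2 \<Longrightarrow> \<eta> \<le> min (1 / (4 * \<beta>)) (d0\<^sup>2 / \<epsilon>)"
      "\<gamma> \<le> 2 \<Longrightarrow> \<eta> = 1 / (4 * \<beta>)"
  shows
    "(let T = T_convex d0 \<eta> \<epsilon>; \<delta> = \<delta>_convex d0 \<epsilon>; \<sigma> = \<sigma>_convex \<eta> \<epsilon>;
          P = run_draws TYPE('a) \<gamma> c \<delta> \<sigma> T;
          y = iterate \<gamma> c \<delta> \<sigma> A \<eta> y0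
      in ((\<forall>\<omega>\<in>set_pmf P. \<forall>t<T. zero_accurate c f (y \<omega> t)) \<longrightarrow>
           measure_pmf.expectation P (\<lambda>\<omega>. L (average T (y \<omega>)) - L ystar) \<le> \<epsilon>) \<and>
         ((\<gamma> < 2 \<longrightarrow> \<epsilon> \<le> 4 * \<beta> * d0\<^sup>2) \<longrightarrow>
           expected_cost TYPE('a) \<gamma> c \<delta> \<sigma> cost T \<le> rate_const \<gamma> * convex_rate \<gamma> c \<beta> d0 \<epsilon>))
     \<and>
     (\<forall>\<mu>. 0 < \<mu> \<and> \<mu> \<le> \<beta> \<and> strongly_convex \<mu> L \<and> \<epsilon> \<le> \<mu> * d0\<^sup>2 \<longrightarrow>
       (let T = T_strong \<mu> d0 \<eta> \<epsilon>; \<delta> = \<delta>_strong \<mu> \<epsilon>; \<sigma> = \<sigma>_strong \<eta> \<epsilon>;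
            P = run_draws TYPE('a) \<gamma> c \<delta> \<sigma> T;
            y = iterate \<gamma> c \<delta> \<sigma> A \<eta> y0
        in ((\<forall>\<omega>\<in>set_pmf P. \<forall>t<T. zero_accurate c f (y \<omega> t)) \<longrightarrow>
             measure_pmf.expectation P
               (\<lambda>\<omega>. L (geometric_average (1 - \<eta> * \<mu>) T (y \<omega>)) - L ystar) \<le> \<epsilon>) \<and>
           expected_cost TYPE('a) \<gamma> c \<delta> \<sigma> cost T
             \<le> rate_const \<gamma> * (1 + ln (\<mu> * d0\<^sup>2 / \<epsilon>)) * strong_rate \<gamma> c \<beta> \<mu> \<epsilon>))
     \<and>
     (\<forall>\<epsilon>'. 0 < \<epsilon>' \<and> \<epsilon>' \<le> \<beta> * d0\<^sup>2 \<longrightarrow>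
        16 powr (\<gamma> + 1) * (\<beta> * d0\<^sup>2 / \<epsilon>' * (c * d0 / \<epsilon>') powr \<gamma>)
          \<le> deterministic_cost \<gamma> c \<beta> d0 \<epsilon>' \<and>
        deterministic_cost \<gamma> c \<beta> d0 \<epsilon>'
          \<le> 2 * 16 powr (\<gamma> + 1) * (\<beta> * d0\<^sup>2 / \<epsilon>' * (c * d0 / \<epsilon>') powr \<gamma>))
     \<and>
     deterministic_cost \<gamma> c \<beta> d0
       \<in> \<Theta>[at_right 0](\<lambda>\<epsilon>'. \<beta> * d0\<^sup>2 * \<epsilon>' powr (-1) * (c * d0 / \<epsilon>') powr \<gamma>)
     \<and>
     deterministic_cost \<gamma> c \<beta> d0 \<in> \<Theta>[at_right 0](\<lambda>\<epsilon>'. \<epsilon>' powr (- (\<gamma> + 1)))"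
proof -
  have \<eta>_le: "\<eta> \<le> 1 / (4 * \<beta>)"
    using \<eta> by (cases "\<gamma> > 2") auto
  have cost: "cost k \<le> c powr \<gamma> * 2 powr (\<gamma> * of_int k)" for k
    using hierarchy(3) by (simp add: dyadic_hierarchy_def)
  have convex_part: "let T = T_convex d0 \<eta> \<epsilon>; \<delta> = \<delta>_convex d0 \<epsilon>; \<sigma> = \<sigma>_convex \<eta> \<epsilon>;
          P = run_draws TYPE('a) \<gamma> c \<delta> \<sigma> T;
          y = iterate \<gamma> c \<delta> \<sigma> A \<eta> y0
      in ((\<forall>w\<in>set_pmf P. \<forall>t<T. zero_accurate c f (y w t)) \<longrightarrow>
           measure_pmf.expectation P (\<lambda>w. L (average T (y w)) - L ystar) \<le> \<epsilon>) \<and>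
         ((\<gamma> < 2 \<longrightarrow> \<epsilon> \<le> 4 * \<beta> * d0\<^sup>2) \<longrightarrow>
           expected_cost TYPE('a) \<gamma> c \<delta> \<sigma> cost T \<le> rate_const \<gamma> * convex_rate \<gamma> c \<beta> d0 \<epsilon>)"
    unfolding Let_def
    by (intro conjI impI
        ml_sgd_convex_accuracy[OF convex smooth minimizer d0 hierarchy(1,3) \<epsilon> \<eta>(1) \<eta>_le]
        expected_cost_convex[OF smooth(1) d0(2) hierarchy(1,2) \<epsilon> \<eta>(1) cost \<eta>(2,3)]) auto
  have strong_part: "let T = T_strong \<mu> d0 \<eta> \<epsilon>; \<delta> = \<delta>_strong \<mu> \<epsilon>; \<sigma> = \<sigma>_strong \<eta> \<epsilon>;
            P = run_draws TYPE('a) \<gamma> c \<delta> \<sigma> T;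
            y = iterate \<gamma> c \<delta> \<sigma> A \<eta> y0
        in ((\<forall>w\<in>set_pmf P. \<forall>t<T. zero_accurate c f (y w t)) \<longrightarrow>
             measure_pmf.expectation P
               (\<lambda>w. L (geometric_average (1 - \<eta> * \<mu>) T (y w)) - L ystar) \<le> \<epsilon>) \<and>
           expected_cost TYPE('a) \<gamma> c \<delta> \<sigma> cost T
             \<le> rate_const \<gamma> * (1 + ln (\<mu> * d0\<^sup>2 / \<epsilon>)) * strong_rate \<gamma> c \<beta> \<mu> \<epsilon>"
    if "0 < \<mu> \<and> \<mu> \<le> \<beta> \<and> strongly_convex \<mu> L \<and> \<epsilon> \<le> \<mu> * d0\<^sup>2" for \<mu>
  proof -
    from that have \<mu>: "0 < \<mu>" "\<mu> \<le> \<beta>" "strongly_convex \<mu> L" "\<epsilon> \<le> \<mu> * d0\<^sup>2"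
      by auto
    show ?thesis
      unfolding Let_def
      by (intro conjI impI
          ml_sgd_strongly_convex_accuracy[OF convex smooth \<mu>(1-3) minimizer d0(1) hierarchy(1,3) \<epsilon> \<mu>(4) \<eta>(1) \<eta>_le]
          expected_cost_strongly_convex[OF smooth(1) hierarchy(1,2) \<epsilon> \<eta>(1) \<mu>(1,2,4) cost \<eta>_le \<eta>(3)]) auto
  qed
  show ?thesis
    using convex_part strong_part
      deterministic_cost_bounds[OF smooth(1) d0(2) hierarchy(2)]
      deterministic_cost_bigtheta[OF smooth(1) d0(2) hierarchy(2)]
      deterministic_cost_bigtheta_accuracy[OF smooth(1) d0(2) hierarchy(2)]
    by blast
qed

end
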